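(* Let $\mathcal X\subset\mathbb R^n$ be Lebesgue measurable and let $g,h_1,\dots,h_k$ be real-valued functions that are $C^\infty$ on an open neighborhood of $\mathcal X\times\mathbb R^m$. Assume there is a constant $\rho>0$ such that for every $x\in\mathcal X$ there is a point $y$ in the interior of $\mathcal Y(x)=\{y\in\mathbb R^m: h_i(x,y)\le0,\ i=1,\dots,k\}$ with $h_i(x,y)\le-\rho$ for all $i=1,\dots,k$. Fix any constant $0<\nu<\rho$, draw $a=(a_1,\dots,a_k)$ uniformly from $[0,\nu]^k$, and set $\widetilde h_i(x,y)=h_i(x,y)+a_i$ for all $i$. Then, with probability one with respect to the random choice of $a$, the set of $x\in\mathcal X$ at which LICQ fails for the perturbed constraints $\{\widetilde h_i(x,y)\}_{i=1}^k$ at some feasible $y$ (i.e. some $y$ with $\widetilde h_i(x,y)\le 0$ for all $i$) has Lebesgue measure zero.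
   Context: LICQ for the constraints $\widetilde h_i\le 0$ holds at a feasible point $(x,y)$ if the vectors $\{\nabla_y\widetilde h_i(x,y):\widetilde h_i(x,y)=0\}$ are linearly independent; otherwise it fails at $(x,y)$. *)

theory Defs
  imports "HOL-Analysis.Analysis"
begin

text \<open>Meaningful for open \<open>U\<close> only, since the derivative is taken at \<open>z\<close> and not within \<open>U\<close>:
  \<open>n\<close>-fold differentiability, with all iterated directional derivatives continuous on \<open>U\<close>.\<close>

primrec C_k_on ::
  "nat \<Rightarrow> ('a::real_normed_vector \<Rightarrow> 'b::real_normed_vector) \<Rightarrow> 'a set \<Rightarrow> bool" where
  "C_k_on 0 f U \<longleftrightarrow> continuous_on U f"
| "C_k_on (Suc n) f U \<longleftrightarrow>
     (\<forall>z\<in>U. f differentiable (at z)) \<and>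
     (\<forall>v. C_k_on n (\<lambda>z. frechet_derivative f (at z) v) U)"

definition C_infinity_on ::
  "('a::real_normed_vector \<Rightarrow> 'b::real_normed_vector) \<Rightarrow> 'a set \<Rightarrow> bool" where
  "C_infinity_on f U \<longleftrightarrow> (\<forall>n. C_k_on n f U)"

definition gradient :: "('a::real_inner \<Rightarrow> real) \<Rightarrow> 'a \<Rightarrow> 'a" where
  "gradient f y = (THE D. GDERIV f y :> D)"

definition feasible_set :: "('k \<Rightarrow> 'a \<times> 'b \<Rightarrow> real) \<Rightarrow> 'a \<Rightarrow> 'b set" where
  "feasible_set h x = {y. \<forall>i. h i (x, y) \<le> 0}"

definition active_set :: "('k \<Rightarrow> 'a \<times> 'b \<Rightarrow> real) \<Rightarrow> 'a \<Rightarrow> 'b \<Rightarrow> 'k set" where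
  "active_set h x y = {i. h i (x, y) = 0}"

text \<open>Linear independence is that of the family of gradients indexed by the active constraints,
  hence the injectivity clause: two active constraints with equal gradients violate LICQ.\<close>

definition LICQ_at :: "('k \<Rightarrow> 'a \<times> 'b::real_inner \<Rightarrow> real) \<Rightarrow> 'a \<Rightarrow> 'b \<Rightarrow> bool" where
  "LICQ_at h x y \<longleftrightarrow>
     inj_on (\<lambda>i. gradient (\<lambda>y'. h i (x, y')) y) (active_set h x y) \<and>
     independent ((\<lambda>i. gradient (\<lambda>y'. h i (x, y')) y) ` active_set h x y)"

definition perturb :: "('k::finite \<Rightarrow> 'z \<Rightarrow> real) \<Rightarrow> real ^ 'k \<Rightarrow> 'k \<Rightarrow> 'z \<Rightarrow> real" where
  "perturb h a i z = h i z + a $ i"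

end

theory Submission
  imports Defs
begin

text \<open>For fixed \<open>x\<close>, LICQ fails for the shift \<open>a\<close> at some feasible \<open>y\<close> only if, for some set \<open>I\<close> of
  constraints, \<open>- a\<close> restricted to \<open>I\<close> is a critical value of \<open>y \<mapsto> (h i (x, y))\<^sub>i\<close>; by Sard's theorem these \<open>a\<close>
  form a null set. The set of all bad pairs \<open>(x, a)\<close> lies in a \<open>\<sigma>\<close>-compact set with null slices at each \<open>x\<close>,
  so by Fubini almost every slice at \<open>a\<close> is null.

  Sard's theorem is proved without smooth changes of coordinates. Milnor's induction on the dimension
  becomes an induction over submanifolds \<open>{z. \<forall>w\<in>\<Omega>. w z = 0}\<close> of one Euclidean space, equipped with
  smooth tangent fields; passing to a hypersurface \<open>g = 0\<close> adds \<open>g\<close> to \<open>\<Omega>\<close> and corrects the fields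
  algebraically. A component that is not tangentially critical is handled by slicing its values.
  Points where an iterated tangential derivative vanishes to first order only are moved to the zero set
  of that derivative. At the remaining points the components are Hoelder continuous along the
  submanifold with an exponent larger than the dimension of the space, so that their values form a
  null set; for this estimate a differentiable chart suffices.\<close>

subsection \<open>Smooth functions\<close>

abbreviation D :: "('a::real_normed_vector \<Rightarrow> 'b::real_normed_vector) \<Rightarrow> 'a \<Rightarrow> 'a \<Rightarrow> 'b" where
  "D f z v \<equiv> frechet_derivative f (at z) v"

lemma D_eqI: "(f has_derivative f') (at z) \<Longrightarrow> D f z v = f' v"
  using frechet_derivative_at by metis

text \<open>On an open set the derivative at a point depends only on values in the set, so agreement
  passes to all iterated derivatives.\<close>

lemma C_k_on_cong:
  assumes "open U" "\<And>z. z \<in> U \<Longrightarrow> f z = g z" "C_k_on n f U"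
  shows "C_k_on n g U"
  using assms(2,3)
proof (induction n arbitrary: f g)
  case 0
  then show ?case by (auto cong: continuous_on_cong)
next
  case (Suc n)
  have "(g has_derivative D f z) (at z)" if "z \<in> U" for z
  proof -
    have "(f has_derivative D f z) (at z)"
      using Suc.prems that by (simp add: frechet_derivative_works[THEN iffD1])
    then show ?thesis
      using has_derivative_transform_within_open[OF _ \<open>open U\<close> that] Suc.prems(1) by blast
  qed
  then have "g differentiable at z" "D f z v = D g z v" if "z \<in> U" for z v
    using that D_eqI differentiableI by metis+
  then show ?case
    using Suc.IH[of "\<lambda>z. D f z v" "\<lambda>z. D g z v" for v] Suc.prems(2) by auto
qed

lemma C_k_on_SucD: "C_k_on (Suc n) f U \<Longrightarrow> C_k_on n f U"
proof (induction n arbitrary: f)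
  case 0
  then show ?case
    by (auto intro!: continuous_at_imp_continuous_on differentiable_imp_continuous_within)
next
  case (Suc n)
  then show ?case by (metis C_k_on.simps(2))
qed

lemma C_k_on_subset: "C_k_on n f U \<Longrightarrow> V \<subseteq> U \<Longrightarrow> C_k_on n f V"
  by (induction n arbitrary: f) (auto intro: continuous_on_subset)

lemma C_k_on_const: "C_k_on n (\<lambda>z. c) U"
  by (induction n arbitrary: c) auto

text \<open>Lets an explicit derivative formula stand in for \<open>frechet_derivative\<close>, so
  that the closure properties below reduce to the usual calculus rules.\<close>

lemma C_k_on_SucI:
  assumes "open U" "\<And>z. z \<in> U \<Longrightarrow> (f has_derivative f' z) (at z)" "\<And>v. C_k_on n (\<lambda>z. f' z v) U"
  shows "C_k_on (Suc n) f U"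
proof -
  have "C_k_on n (\<lambda>z. D f z v) U" for v
    by (rule C_k_on_cong[OF \<open>open U\<close> _ assms(3)[of v]]) (metis D_eqI assms(2))
  then show ?thesis
    using assms(2) by (auto intro: differentiableI)
qed

lemma C_k_on_has_derivative: "C_k_on (Suc n) f U \<Longrightarrow> z \<in> U \<Longrightarrow> (f has_derivative D f z) (at z)"
  by (simp add: frechet_derivative_works[THEN iffD1])

lemma C_k_on_add:
  assumes "open U" "C_k_on n f U" "C_k_on n g U"
  shows "C_k_on n (\<lambda>z. f z + g z) U"
  using assms(2,3)
proof (induction n arbitrary: f g)
  case 0
  then show ?case by (auto intro: continuous_intros)
next
  case (Suc n)
  show ?case
  proof (rule C_k_on_SucI[OF \<open>open U\<close>])
    show "((\<lambda>z. f z + g z) has_derivative (\<lambda>v. D f z v + D g z v)) (at z)" if "z \<in> U" for z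
      by (intro has_derivative_add Suc.prems[THEN C_k_on_has_derivative, OF that])
    show "C_k_on n (\<lambda>z. D f z v + D g z v) U" for v
      using Suc by simp
  qed
qed

lemma C_k_on_mult:
  fixes f g :: "'a::real_normed_vector \<Rightarrow> real"
  assumes "open U" "C_k_on n f U" "C_k_on n g U"
  shows "C_k_on n (\<lambda>z. f z * g z) U"
  using assms(2,3)
proof (induction n arbitrary: f g)
  case 0
  then show ?case by (auto intro: continuous_intros)
next
  case (Suc n)
  show ?case
  proof (rule C_k_on_SucI[OF \<open>open U\<close>])
    show "((\<lambda>z. f z * g z) has_derivative (\<lambda>v. f z * D g z v + D f z v * g z)) (at z)" if "z \<in> U" for z
      by (intro has_derivative_mult Suc.prems[THEN C_k_on_has_derivative, OF that])
    show "C_k_on n (\<lambda>z. f z * D g z v + D f z v * g z) U" for v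
      using Suc.prems C_k_on_SucD by (intro C_k_on_add Suc.IH \<open>open U\<close>) auto
  qed
qed

text \<open>The derivative of \<open>1 / f\<close> is a product of copies of \<open>1 / f\<close>
  and a derivative of \<open>f\<close>, so the induction hypothesis feeds itself.\<close>

lemma C_k_on_inverse:
  fixes f :: "'a::real_normed_vector \<Rightarrow> real"
  assumes "open U" "\<And>z. z \<in> U \<Longrightarrow> f z \<noteq> 0" "C_k_on n f U"
  shows "C_k_on n (\<lambda>z. inverse (f z)) U"
  using assms(3)
proof (induction n)
  case 0
  then show ?case using assms by (auto intro: continuous_intros)
next
  case (Suc n)
  show ?case
  proof (rule C_k_on_SucI[OF \<open>open U\<close>])
    show "((\<lambda>z. inverse (f z)) has_derivative (\<lambda>v. -1 * (inverse (f z) * D f z v * inverse (f z)))) (at z)"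
      if "z \<in> U" for z
      using Deriv.has_derivative_inverse[OF assms(2)[OF that] C_k_on_has_derivative[OF Suc.prems that]] by simp
    show "C_k_on n (\<lambda>z. -1 * (inverse (f z) * D f z v * inverse (f z))) U" for v
      using Suc.prems Suc.IH C_k_on_SucD[OF Suc.prems]
      by (intro C_k_on_mult C_k_on_const \<open>open U\<close>) auto
  qed
qed

lemma C_infinity_onD: "C_infinity_on f U \<Longrightarrow> z \<in> U \<Longrightarrow> (f has_derivative D f z) (at z)"
  unfolding C_infinity_on_def using C_k_on.simps(2)[of 0 f U] frechet_derivative_works[THEN iffD1] by blast

lemma C_infinity_on_continuous: "C_infinity_on f U \<Longrightarrow> continuous_on U f"
  unfolding C_infinity_on_def using C_k_on.simps(1) by blast

lemma C_infinity_on_D: "C_infinity_on f U \<Longrightarrow> C_infinity_on (\<lambda>z. D f z v) U"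
  unfolding C_infinity_on_def using C_k_on.simps(2) by blast

lemma C_infinity_on_cong:
  "open U \<Longrightarrow> C_infinity_on f U \<Longrightarrow> (\<And>z. z \<in> U \<Longrightarrow> f z = g z) \<Longrightarrow> C_infinity_on g U"
  unfolding C_infinity_on_def using C_k_on_cong by metis

lemma C_infinity_on_subset: "C_infinity_on f U \<Longrightarrow> V \<subseteq> U \<Longrightarrow> C_infinity_on f V"
  unfolding C_infinity_on_def using C_k_on_subset by blast

lemma C_infinity_on_const: "C_infinity_on (\<lambda>z. c) U"
  unfolding C_infinity_on_def using C_k_on_const by blast

lemma C_infinity_on_add:
  "open U \<Longrightarrow> C_infinity_on f U \<Longrightarrow> C_infinity_on g U \<Longrightarrow> C_infinity_on (\<lambda>z. f z + g z) U"
  unfolding C_infinity_on_def using C_k_on_add by blast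

lemma C_infinity_on_mult:
  fixes f g :: "'a::real_normed_vector \<Rightarrow> real"
  shows "open U \<Longrightarrow> C_infinity_on f U \<Longrightarrow> C_infinity_on g U \<Longrightarrow> C_infinity_on (\<lambda>z. f z * g z) U"
  unfolding C_infinity_on_def using C_k_on_mult by blast

lemma C_infinity_on_diff:
  fixes f g :: "'a::real_normed_vector \<Rightarrow> real"
  shows "open U \<Longrightarrow> C_infinity_on f U \<Longrightarrow> C_infinity_on g U \<Longrightarrow> C_infinity_on (\<lambda>z. f z - g z) U"
  using C_infinity_on_add[OF _ _ C_infinity_on_mult[OF _ C_infinity_on_const[of "-1"]], of U f g] by simp

lemma C_infinity_on_divide:
  fixes f g :: "'a::real_normed_vector \<Rightarrow> real"
  assumes "open U" "C_infinity_on f U" "C_infinity_on g U" "\<And>z. z \<in> U \<Longrightarrow> g z \<noteq> 0"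
  shows "C_infinity_on (\<lambda>z. f z / g z) U"
proof -
  have "C_infinity_on (\<lambda>z. inverse (g z)) U"
    using assms C_k_on_inverse unfolding C_infinity_on_def by blast
  then show ?thesis
    using C_infinity_on_mult[OF assms(1,2)] by (simp add: divide_inverse)
qed

lemma C_infinity_on_sum:
  assumes "open U" "\<And>i. i \<in> I \<Longrightarrow> C_infinity_on (f i) U"
  shows "C_infinity_on (\<lambda>z. \<Sum>i\<in>I. f i z) U"
  using assms(2)
  by (induction I rule: infinite_finite_induct)
    (auto simp: C_infinity_on_const intro: C_infinity_on_add[OF \<open>open U\<close>])

text \<open>Smoothness is defined through constant directions only; a varying direction
  \<open>Y z\<close> is expanded in the basis, which leaves smooth coefficients times derivatives in
  constant directions.\<close>

lemma C_infinity_on_directional: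
  fixes f :: "'a::euclidean_space \<Rightarrow> real"
  assumes "open U" "C_infinity_on f U" "\<And>b. b \<in> Basis \<Longrightarrow> C_infinity_on (\<lambda>z. Y z \<bullet> b) U"
  shows "C_infinity_on (\<lambda>z. D f z (Y z)) U"
proof (rule C_infinity_on_cong[OF \<open>open U\<close>])
  show "C_infinity_on (\<lambda>z. \<Sum>b\<in>Basis. (Y z \<bullet> b) * D f z b) U"
    by (intro C_infinity_on_sum C_infinity_on_mult C_infinity_on_D assms)
  show "(\<Sum>b\<in>Basis. (Y z \<bullet> b) * D f z b) = D f z (Y z)" if "z \<in> U" for z
  proof -
    have "linear (D f z)"
      using C_infinity_onD[OF assms(2) that] has_derivative_linear by blast
    then have "D f z (\<Sum>b\<in>Basis. (Y z \<bullet> b) *\<^sub>R b) = (\<Sum>b\<in>Basis. (Y z \<bullet> b) * D f z b)"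
      by (simp add: linear_sum linear_cmul)
    then show ?thesis by (simp add: euclidean_representation)
  qed
qed

section \<open>Slices of smooth functions on a product\<close>

lemma has_derivative_slice:
  assumes "(f has_derivative f') (at (x, y))"
  shows "((\<lambda>y. f (x, y)) has_derivative (\<lambda>v. f' (0, v))) (at y)"
  by (rule has_derivative_compose[of "Pair x" _ y UNIV f f', OF _ assms]) (auto intro!: derivative_eq_intros)

lemma C_k_on_slice:
  fixes f :: "'a::real_normed_vector \<times> 'b::real_normed_vector \<Rightarrow> 'c::real_normed_vector"
  assumes "open U" "C_k_on n f U"
  shows "C_k_on n (\<lambda>y. f (x, y)) {y. (x, y) \<in> U}"
  using assms(2)
proof (induction n arbitrary: f)
  case 0
  then show ?case
    by (auto intro!: continuous_on_compose2[of U f _ "Pair x"] continuous_intros)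
next
  case (Suc n)
  have op: "open {y. (x, y) \<in> U}"
    using open_vimage[OF \<open>open U\<close>, of "Pair x"] by (simp add: vimage_def continuous_on_Pair)
  show ?case
  proof (rule C_k_on_SucI[OF op])
    show "((\<lambda>y. f (x, y)) has_derivative (\<lambda>v. D f (x, y) (0, v))) (at y)" if "y \<in> {y. (x, y) \<in> U}" for y
      using has_derivative_slice[OF C_k_on_has_derivative[OF Suc.prems]] that by simp
    show "C_k_on n (\<lambda>y. D f (x, y) (0, v)) {y. (x, y) \<in> U}" for v
      using Suc.IH[of "\<lambda>z. D f z (0, v)"] Suc.prems by simp
  qed
qed

lemma D_slice:
  fixes f :: "'a::real_normed_vector \<times> 'b::real_normed_vector \<Rightarrow> 'c::real_normed_vector"
  assumes "C_infinity_on f U" "(x, y) \<in> U"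
  shows "D (\<lambda>y. f (x, y)) y v = D f (x, y) (0, v)"
  by (rule D_eqI[OF has_derivative_slice[OF C_infinity_onD[OF assms]]])

subsection \<open>Null sets\<close>

text \<open>An open set is \<sigma>-compact, hence so is \<open>K\<close>, and a continuous image of
  a \<sigma>-compact set is a countable union of compact sets. This makes projections Borel in all
  later uses.\<close>

lemma closedin_image_borel:
  fixes p :: "'a::euclidean_space \<Rightarrow> 'b::euclidean_space"
  assumes "open U" "closedin (top_of_set U) K" "continuous_on K p"
  shows "p ` K \<in> sets borel"
proof -
  obtain C where C: "closed C" "K = U \<inter> C"
    using assms(2) by (auto simp: closedin_closed)
  obtain F where F: "\<And>n::nat. compact (F n)" "(\<Union>n. F n) = U"
    using open_Union_compact_subsets[OF \<open>open U\<close>] by metis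
  have "compact (p ` (F n \<inter> C))" for n
  proof (rule compact_continuous_image)
    have "F n \<subseteq> U" using F(2) by blast
    then show "continuous_on (F n \<inter> C) p"
      using C by (intro continuous_on_subset[OF assms(3)]) auto
    show "compact (F n \<inter> C)"
      using F C by (simp add: compact_Int_closed)
  qed
  then have "(\<Union>n. p ` (F n \<inter> C)) \<in> sets borel"
    by (intro sets.countable_UN) (auto intro: borel_compact)
  moreover have "(\<Union>n. p ` (F n \<inter> C)) = p ` K"
    using F C by blast
  ultimately show ?thesis by simp
qed

text \<open>The point \<open>a + (t - a $ j) *\<^sub>R axis j 1\<close> is \<open>a\<close> with
  coordinate \<open>j\<close> replaced by \<open>t\<close>, so the hypothesis concerns the slice of
  \<open>B\<close> at height \<open>t\<close>, thickened to a cylinder in direction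
  \<open>j\<close>.\<close>

lemma null_sets_coordinate_slices:
  fixes B :: "(real ^ 'k) set"
  assumes B: "B \<in> sets borel"
    and AE: "AE t in lborel. {a. a + (t - a $ j) *\<^sub>R axis j 1 \<in> B} \<in> null_sets lborel"
  shows "B \<in> null_sets lborel"
proof -
  let ?e = "axis j 1 :: real ^ 'k"
  \<comment> \<open>Fubini on \<open>(a, t)\<close>: almost every line in direction \<open>?e\<close> meets \<open>B\<close> in a null set. Fubini on
    \<open>(a, s)\<close>: then some translate of \<open>B\<close> is null. This avoids splitting off the coordinate \<open>j\<close>.\<close>
  have [measurable]: "B \<in> sets borel" by fact
  have [measurable]: "(\<lambda>a :: real ^ 'k. a $ j) \<in> borel_measurable borel"
    by (intro borel_measurable_continuous_onI continuous_intros)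
  have 1: "AE t in lborel. AE a in lborel. a + (t - a $ j) *\<^sub>R ?e \<notin> B"
    using AE
  proof eventually_elim
    case (elim t)
    then show ?case by (rule AE_not_in[THEN AE_mp]) simp
  qed
  have m1: "{x \<in> space (lborel \<Otimes>\<^sub>M lborel). fst x + (snd x - fst x $ j) *\<^sub>R ?e \<notin> B}
      \<in> sets (lborel \<Otimes>\<^sub>M lborel)"
    by measurable
  have m2: "{x \<in> space (lborel \<Otimes>\<^sub>M lborel). fst x + snd x *\<^sub>R ?e \<notin> B} \<in> sets (lborel \<Otimes>\<^sub>M lborel)"
    by measurable
  have "AE a in lborel. AE t in lborel. a + (t - a $ j) *\<^sub>R ?e \<notin> B"
    using lborel_pair.AE_commute[OF m1] 1 by simp
  then have "AE a in lborel. AE s in lborel. a + s *\<^sub>R ?e \<notin> B"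
  proof eventually_elim
    case (elim a)
    \<comment> \<open>Translation invariance justifies the substitution
      \<open>t = a $ j + s\<close>.\<close>
    have "AE t in distr lborel borel (\<lambda>s. a $ j + s). a + (t - a $ j) *\<^sub>R ?e \<notin> B"
      unfolding lborel_distr_plus using elim .
    then show ?case
      by (subst (asm) AE_distr_iff) auto
  qed
  then have "AE s in lborel. AE a in lborel. a + s *\<^sub>R ?e \<notin> B"
    using lborel_pair.AE_commute[OF m2] by simp
  \<comment> \<open>\<open>lborel\<close> is not the zero measure, so what holds for almost all
    \<open>s\<close> holds for some \<open>s\<close>.\<close>
  then have "\<exists>s. AE a in lborel. a + s *\<^sub>R ?e \<notin> B"
    by (rule eventually_happens'[rotated]) (simp add: ae_filter_eq_bot_iff)
  then obtain s where s: "AE a in lborel. a + s *\<^sub>R ?e \<notin> B" ..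
  have "AE a in distr lborel borel (\<lambda>a. s *\<^sub>R ?e + a). a \<notin> B"
    using s by (subst AE_distr_iff) (auto simp: add.commute)
  then have "AE a in lborel. a \<notin> B"
    unfolding lborel_distr_plus .
  then show ?thesis
    using AE_iff_null_sets[of B lborel] B by simp
qed

lemma null_sets_cylinder:
  fixes j :: "'k::finite"
  assumes "negligible N"
  shows "\<exists>B \<in> null_sets lborel. {a :: real ^ 'k. a $ j \<in> N} \<subseteq> B"
proof -
  have "N \<in> null_sets (completion lborel)"
    using assms by (simp only: negligible_iff_null_sets)
  then have "\<exists>M \<in> null_sets lborel. N \<subseteq> M"
    by (rule null_sets_completion_iff2[THEN iffD1])
  then obtain M where M: "M \<in> null_sets lborel" "N \<subseteq> M" ..
  define B where "B = (\<lambda>a :: real ^ 'k. a $ j) -` M"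
  have "B \<in> null_sets lborel"
  proof (rule null_sets_coordinate_slices)
    have "(\<lambda>a :: real ^ 'k. a $ j) \<in> borel_measurable borel"
      by (intro borel_measurable_continuous_onI continuous_intros)
    moreover have "M \<in> sets borel" using null_setsD2[OF M(1)] by simp
    ultimately have "(\<lambda>a :: real ^ 'k. a $ j) -` M \<inter> space borel \<in> sets borel"
      by (rule measurable_sets)
    then show "B \<in> sets borel" by (simp add: B_def)
    have "AE t in lborel. t \<notin> M"
      using M(1) by (rule AE_not_in)
    then show "AE t in lborel. {a. a + (t - a $ j) *\<^sub>R axis j 1 \<in> B} \<in> null_sets lborel"
    proof eventually_elim
      case (elim t)
      have "(a + (t - a $ j) *\<^sub>R axis j 1) $ j = t" for a :: "real ^ 'k" by simp
      then have "a + (t - a $ j) *\<^sub>R axis j 1 \<notin> B" for a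
        using elim unfolding B_def by (metis vimageD)
      then have "{a. a + (t - a $ j) *\<^sub>R axis j 1 \<in> B} = {}" by blast
      then show ?case using null_sets.empty_sets[of lborel] by metis
    qed
  qed
  moreover have "{a :: real ^ 'k. a $ j \<in> N} \<subseteq> B"
    unfolding B_def using M(2) by auto
  ultimately show ?thesis by blast
qed

lemma negligible_coordinate_slices:
  fixes B :: "(real ^ 'k) set"
  assumes B: "B \<in> sets borel"
    and slice: "\<And>t. negligible {a. a + (t - a $ j) *\<^sub>R axis j 1 \<in> B}"
  shows "negligible B"
proof -
  have "{a. a + (t - a $ j) *\<^sub>R axis j 1 \<in> B} \<in> null_sets lborel" for t
  proof -
    have "(\<lambda>a. a + (t - a $ j) *\<^sub>R axis j 1) \<in> borel_measurable (borel :: (real ^ 'k) measure)"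
      by (intro borel_measurable_continuous_onI continuous_intros)
    from measurable_sets[OF this B]
    have "{a. a + (t - a $ j) *\<^sub>R axis j 1 \<in> B} \<in> sets lborel"
      by (simp add: vimage_def)
    then show ?thesis
      using slice[of t] by (simp add: negligible_iff_null_sets null_sets_completion_iff)
  qed
  then have "B \<in> null_sets lborel"
    by (intro null_sets_coordinate_slices[OF B, of j]) simp
  then show ?thesis
    by (simp add: negligible_iff_null_sets null_sets_completionI)
qed

lemma borel_image_zero_set:
  fixes p :: "'a::euclidean_space \<Rightarrow> 'b::euclidean_space" and \<Phi> :: "('a \<Rightarrow> real) set"
  assumes "open W" "finite \<Phi>" "\<And>\<phi>. \<phi> \<in> \<Phi> \<Longrightarrow> continuous_on W \<phi>" "continuous_on W p"
  shows "p ` {q \<in> W. \<forall>\<phi>\<in>\<Phi>. \<phi> q = 0} \<in> sets borel"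
proof (rule closedin_image_borel[OF \<open>open W\<close>])
  \<comment> \<open>Summing squares turns the finite system into a single equation.\<close>
  have "closedin (top_of_set W) {q \<in> W. (\<Sum>\<phi>\<in>\<Phi>. (\<phi> q)\<^sup>2) = 0}"
    by (intro continuous_closedin_preimage_constant continuous_intros assms)
  also have "{q \<in> W. (\<Sum>\<phi>\<in>\<Phi>. (\<phi> q)\<^sup>2) = 0} = {q \<in> W. \<forall>\<phi>\<in>\<Phi>. \<phi> q = 0}"
    using \<open>finite \<Phi>\<close> by (auto simp: sum_nonneg_eq_0_iff)
  finally show "closedin (top_of_set W) {q \<in> W. \<forall>\<phi>\<in>\<Phi>. \<phi> q = 0}" .
  show "continuous_on {q \<in> W. \<forall>\<phi>\<in>\<Phi>. \<phi> q = 0} p"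
    using assms(4) by (rule continuous_on_subset) auto
qed

lemma negligible_cylinder:
  fixes j :: "'k::finite"
  assumes "negligible N"
  shows "negligible {a :: real ^ 'k. a $ j \<in> N}"
proof -
  obtain B where "B \<in> null_sets lborel" "{a :: real ^ 'k. a $ j \<in> N} \<subseteq> B"
    using null_sets_cylinder[OF assms] by blast
  then show ?thesis
    by (meson negligible_iff_null_sets negligible_subset null_sets_completionI)
qed

lemma negligible_UN:
  assumes "countable I" "\<And>i. i \<in> I \<Longrightarrow> negligible (A i)"
  shows "negligible (\<Union>i\<in>I. A i)"
  using assms by (intro negligible_countable_Union) auto

section \<open>Images under maps with Hoelder exponent above the dimension\<close>

lemma negligible_image_Holder:
  fixes F :: "'a::euclidean_space \<Rightarrow> real"
  assumes "bounded A"
    and hol: "\<And>x y. x \<in> A \<Longrightarrow> y \<in> A \<Longrightarrow> \<bar>F x - F y\<bar> \<le> C * norm (x - y) ^ Suc DIM('a)"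
  shows "negligible (F ` A)"
proof -
  let ?N = "DIM('a)"
  obtain R0 where R0: "\<And>z. z \<in> A \<Longrightarrow> norm z \<le> R0"
    using \<open>bounded A\<close> bounded_iff by blast
  obtain R :: nat where R: "real R \<ge> max 1 R0" using real_arch_simple by blast
  \<comment> \<open>Clipping \<open>C\<close> at zero keeps multiplication by the constant
    monotone.\<close>
  define C' where "C' = max C 0"
  have hol': "\<bar>F x - F y\<bar> \<le> C' * norm (x - y) ^ Suc ?N" if "x \<in> A" "y \<in> A" for x y
  proof -
    have "C * norm (x - y) ^ Suc ?N \<le> C' * norm (x - y) ^ Suc ?N"
      unfolding C'_def by (intro mult_right_mono) auto
    then show ?thesis using hol[OF that] by linarith
  qed
  \<comment> \<open>At most \<open>(3 * R * m) ^ N\<close> cells, each with image in an interval of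
    length \<open>2 * r\<close>, give total length \<open>K / m\<close>: exactly one power of
    \<open>m\<close> survives.\<close>
  define K where "K = real (3 * R) ^ ?N * (2 * C' * real ?N ^ Suc ?N)"
  show ?thesis
  proof (rule negligible_outer_le[THEN iffD2], intro allI impI)
    fix e :: real assume "e > 0"
    obtain m :: nat where m: "real m > max 1 (K / e)" using reals_Archimedean2 by blast
    then have "m > 0" by simp
    have Ke: "K / real m \<le> e" using m \<open>e > 0\<close> \<open>m > 0\<close> by (simp add: field_simps)
    \<comment> \<open>A grid of mesh \<open>1 / m\<close> has about \<open>m ^ N\<close> cells, each with image of length about \<open>1 / m ^ (N + 1)\<close>.\<close>
    define cl where "cl z = (\<lambda>b\<in>Basis. \<lfloor>real m * (z \<bullet> b)\<rfloor>)" for z :: 'a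
    define P where "P = (Basis :: 'a set) \<rightarrow>\<^sub>E {- int (m * R)..int (m * R)}"
    define r where "r = C' * (real ?N / real m) ^ Suc ?N"
    define rep where "rep k = (SOME z. z \<in> A \<and> cl z = k)" for k
    have finP: "finite P" unfolding P_def by (intro finite_PiE) auto
    have cardP: "card P = (2 * m * R + 1) ^ ?N"
    proof -
      have "card {- int (m * R)..int (m * R)} = 2 * m * R + 1"
        using nat_int[of "2 * m * R + 1"] by (simp add: algebra_simps)
      then show ?thesis
        unfolding P_def by (subst card_PiE) simp_all
    qed
    have clP: "cl z \<in> P" if "z \<in> A" for z
    proof -
      have "- int (m * R) \<le> \<lfloor>real m * (z \<bullet> b)\<rfloor> \<and> \<lfloor>real m * (z \<bullet> b)\<rfloor> \<le> int (m * R)" if "b \<in> Basis" for b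
      proof -
        have "\<bar>z \<bullet> b\<bar> \<le> real R"
          using Basis_le_norm[OF that, of z] R0[OF \<open>z \<in> A\<close>] R by linarith
        then have "\<bar>real m * (z \<bullet> b)\<bar> \<le> real m * real R"
          by (simp add: abs_mult mult_left_mono)
        then show ?thesis by (auto simp: le_floor_iff floor_le_iff abs_le_iff)
      qed
      then show ?thesis unfolding P_def cl_def by auto
    qed
    have near: "norm (x - y) \<le> real ?N / real m" if "cl x = cl y" for x y
    proof -
      have "\<bar>(x - y) \<bullet> b\<bar> \<le> 1 / real m" if "b \<in> Basis" for b
      proof -
        have "\<lfloor>real m * (x \<bullet> b)\<rfloor> = \<lfloor>real m * (y \<bullet> b)\<rfloor>"
          using fun_cong[OF \<open>cl x = cl y\<close>, of b] that by (simp add: cl_def)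
        then have "\<bar>real m * (x \<bullet> b) - real m * (y \<bullet> b)\<bar> \<le> 1"
          by linarith
        then have "real m * \<bar>(x - y) \<bullet> b\<bar> \<le> 1"
          by (simp add: inner_diff_left abs_mult flip: right_diff_distrib)
        then show ?thesis using \<open>m > 0\<close> by (simp add: field_simps)
      qed
      then have "(\<Sum>b\<in>Basis. \<bar>(x - y) \<bullet> b\<bar>) \<le> (\<Sum>b\<in>(Basis :: 'a set). 1 / real m)"
        by (rule sum_mono)
      then show ?thesis using norm_le_l1[of "x - y"] by simp
    qed
    have "F ` A \<subseteq> (\<Union>k\<in>P. cball (F (rep k)) r)"
    proof clarify
      fix z assume "z \<in> A"
      have "rep (cl z) \<in> A \<and> cl (rep (cl z)) = cl z"
        unfolding rep_def by (rule someI[of _ z]) (use \<open>z \<in> A\<close> in auto)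
      then have "\<bar>F (rep (cl z)) - F z\<bar> \<le> C' * norm (rep (cl z) - z) ^ Suc ?N" "norm (rep (cl z) - z) \<le> real ?N / real m"
        using hol' \<open>z \<in> A\<close> near by blast+
      moreover have "C' * norm (rep (cl z) - z) ^ Suc ?N \<le> r"
        unfolding r_def using calculation(2) by (intro mult_left_mono power_mono) (auto simp: C'_def)
      ultimately have "F z \<in> cball (F (rep (cl z))) r"
        by (simp add: dist_real_def)
      then show "F z \<in> (\<Union>k\<in>P. cball (F (rep k)) r)"
        using clP[OF \<open>z \<in> A\<close>] by blast
    qed
    moreover have "(\<Union>k\<in>P. cball (F (rep k)) r) \<in> lmeasurable"
      using finP by (intro fmeasurable.finite_UN) auto
    moreover have "measure lebesgue (\<Union>k\<in>P. cball (F (rep k)) r) \<le> e"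
    proof -
      have "r \<ge> 0" unfolding r_def C'_def by simp
      have "measure lebesgue (\<Union>k\<in>P. cball (F (rep k)) r) \<le> (\<Sum>k\<in>P. measure lebesgue (cball (F (rep k)) r))"
        using finP by (intro measure_UNION_le) auto
      also have "\<dots> = real (card P) * (2 * r)"
        using \<open>r \<ge> 0\<close> by (simp add: cball_eq_atLeastAtMost)
      also have "\<dots> \<le> (real (3 * R) * real m) ^ ?N * (2 * r)"
      proof (rule mult_right_mono)
        \<comment> \<open>The extra 1 in the number of grid points per axis is absorbed by enlarging
          2 to 3.\<close>
        have "1 \<le> m * R" using \<open>m > 0\<close> R by (cases R) auto
        then have "2 * m * R + 1 \<le> 3 * R * m" by (simp add: algebra_simps)
        then have "real (2 * m * R + 1) \<le> real (3 * R) * real m"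
          by (metis of_nat_le_iff of_nat_mult)
        then show "real (card P) \<le> (real (3 * R) * real m) ^ ?N"
          unfolding cardP of_nat_power by (intro power_mono) auto
      qed (use \<open>r \<ge> 0\<close> in auto)
      also have "\<dots> = K / real m"
        unfolding r_def K_def power_mult_distrib power_divide power_Suc[of "real m"]
        using \<open>m > 0\<close> by simp
      finally show ?thesis using Ke by linarith
    qed
    ultimately show "\<exists>T. F ` A \<subseteq> T \<and> T \<in> lmeasurable \<and> measure lebesgue T \<le> e" by blast
  qed
qed

subsection \<open>Tangent frames and charts\<close>

text \<open>The tangential derivative is again a function of the point, so it can be
  iterated.\<close>

definition td :: "('a::euclidean_space \<Rightarrow> 'a \<Rightarrow> 'a) \<Rightarrow> 'a \<Rightarrow> ('a \<Rightarrow> real) \<Rightarrow> 'a \<Rightarrow> real" where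
  "td T b F = (\<lambda>z. D F z (T z b))"

text \<open>Vanishing to order \<open>n\<close>: the iterated tangential derivatives of orders 0 to
  \<open>n - 1\<close> are zero. The fields are differentiated as well, and order 0 imposes
  nothing.\<close>

primrec vanishing ::
  "('a::euclidean_space \<Rightarrow> 'a \<Rightarrow> 'a) \<Rightarrow> nat \<Rightarrow> ('a \<Rightarrow> real) \<Rightarrow> 'a \<Rightarrow> bool" where
  "vanishing T 0 F z \<longleftrightarrow> True"
| "vanishing T (Suc n) F z \<longleftrightarrow> F z = 0 \<and> (\<forall>b\<in>Basis. vanishing T n (td T b F) z)"

text \<open>The level sets of \<open>\<Omega>\<close> are submanifolds, and \<open>T z\<close>, extended linearly, is a smooth (not necessarily
  orthogonal) projection onto the common kernel of the \<open>D w z\<close>. Keeping one field per basis vector,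
  instead of a basis of the kernel, gives tangent vectors bounded coefficients for free.\<close>

locale tangent_frame =
  fixes U :: "'a::euclidean_space set" and \<Omega> :: "('a \<Rightarrow> real) set" and T :: "'a \<Rightarrow> 'a \<Rightarrow> 'a"
  assumes open_U: "open U"
    and finite_\<Omega>: "finite \<Omega>"
    and smooth_\<Omega>: "w \<in> \<Omega> \<Longrightarrow> C_infinity_on w U"
    and smooth_T: "b \<in> Basis \<Longrightarrow> c \<in> Basis \<Longrightarrow> C_infinity_on (\<lambda>z. T z b \<bullet> c) U"
    and tangent: "z \<in> U \<Longrightarrow> w \<in> \<Omega> \<Longrightarrow> b \<in> Basis \<Longrightarrow> D w z (T z b) = 0"
    and frame: "z \<in> U \<Longrightarrow> (\<And>w. w \<in> \<Omega> \<Longrightarrow> D w z v = 0) \<Longrightarrow> (\<Sum>b\<in>Basis. (v \<bullet> b) *\<^sub>R T z b) = v"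
    and indep: "\<And>c :: ('a \<Rightarrow> real) \<Rightarrow> real. z \<in> U \<Longrightarrow> (\<And>v. (\<Sum>w\<in>\<Omega>. c w * D w z v) = 0) \<Longrightarrow> w \<in> \<Omega> \<Longrightarrow> c w = 0"
begin

lemma linear_D: "w \<in> \<Omega> \<Longrightarrow> z \<in> U \<Longrightarrow> linear (D w z)"
  using C_infinity_onD[OF smooth_\<Omega>] has_derivative_linear by blast

lemma smooth_td: "C_infinity_on F U \<Longrightarrow> b \<in> Basis \<Longrightarrow> C_infinity_on (td T b F) U"
  unfolding td_def by (intro C_infinity_on_directional open_U smooth_T)

text \<open>The parameter domain is an open convex set of the full space, so that ordinary calculus
  along segments applies; \<open>P\<close> recovers the parameter of a point near \<open>z0\<close>.
  The compact \<open>K\<close> and the bound \<open>L\<close> supply the uniform constants of the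
  Hoelder estimate.\<close>

lemma chart:
  assumes "z0 \<in> U" and z0: "\<And>w. w \<in> \<Omega> \<Longrightarrow> w z0 = 0"
  obtains V Q K \<psi> \<psi>' P L where
    "open V" "z0 \<in> V" "V \<subseteq> U" "open (Q :: 'a set)" "convex Q" "compact K" "K \<subseteq> U" "L \<ge> 0"
    "\<And>s. s \<in> Q \<Longrightarrow> \<psi> s \<in> K"
    "\<And>s w. s \<in> Q \<Longrightarrow> w \<in> \<Omega> \<Longrightarrow> w (\<psi> s) = 0"
    "\<And>s. s \<in> Q \<Longrightarrow> (\<psi> has_derivative \<psi>' s) (at s)"
    "\<And>s v. s \<in> Q \<Longrightarrow> norm (\<psi>' s v) \<le> L * norm v"
    "bounded_linear (P :: 'a \<Rightarrow> 'a)"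
    "\<And>z. z \<in> V \<Longrightarrow> (\<And>w. w \<in> \<Omega> \<Longrightarrow> w z = 0) \<Longrightarrow> P z \<in> Q \<and> \<psi> (P z) = z"
proof -
  \<comment> \<open>\<open>gr w\<close> is the gradient of \<open>w\<close> at
    \<open>z0\<close>.\<close>
  define gr where "gr w = (\<Sum>b\<in>Basis. D w z0 b *\<^sub>R b)" for w
  have gr: "gr w \<bullet> v = D w z0 v" if "w \<in> \<Omega>" for w v
  proof -
    have "D w z0 (\<Sum>b\<in>Basis. (v \<bullet> b) *\<^sub>R b) = (\<Sum>b\<in>Basis. (v \<bullet> b) * D w z0 b)"
      using linear_D[OF that \<open>z0 \<in> U\<close>] by (simp add: linear_sum linear_cmul)
    then have "D w z0 v = (\<Sum>b\<in>Basis. (v \<bullet> b) * D w z0 b)"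
      by (simp only: euclidean_representation)
    then show ?thesis
      by (simp add: gr_def inner_sum_left mult.commute[of "_ \<bullet> _"] inner_commute[of v])
  qed
  \<comment> \<open>\<open>P\<close> is the projection onto the common kernel of the
    \<open>D w z0\<close> that the frame provides.\<close>
  define P where "P v = (\<Sum>b\<in>Basis. (v \<bullet> b) *\<^sub>R T z0 b)" for v
  have linP: "linear P"
    unfolding P_def by (rule linearI) (simp_all add: inner_add_left scaleR_add_left sum.distrib scaleR_sum_right)
  then have blP: "bounded_linear P" by (simp add: linear_conv_bounded_linear)
  have DP: "D w z0 (P v) = 0" if "w \<in> \<Omega>" for w v
    unfolding P_def using linear_D[OF that \<open>z0 \<in> U\<close>] tangent[OF \<open>z0 \<in> U\<close> that]
    by (simp add: linear_sum linear_cmul)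
  have PV: "P v = v" if "\<And>w. w \<in> \<Omega> \<Longrightarrow> D w z0 v = 0" for v
    unfolding P_def using frame[OF \<open>z0 \<in> U\<close>] that by blast
  have PP: "P (P v) = P v" for v
    by (rule PV) (rule DP)
  \<comment> \<open>On the zero set \<open>\<Phi>\<close> agrees with the linear map \<open>P\<close>, so the inverse of \<open>\<Phi>\<close> parametrizes the zero
    set over the range of \<open>P\<close>; composing with \<open>P\<close> makes the chart defined on an open ball.\<close>
  define \<Phi> where "\<Phi> z = (\<Sum>w\<in>\<Omega>. w z *\<^sub>R gr w) + P z" for z
  define d\<Phi> where "d\<Phi> z v = (\<Sum>w\<in>\<Omega>. D w z v *\<^sub>R gr w) + P v" for z v
  have der\<Phi>: "(\<Phi> has_derivative d\<Phi> z) (at z)" if "z \<in> U" for z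
    unfolding \<Phi>_def d\<Phi>_def
    by (intro has_derivative_add has_derivative_sum has_derivative_scaleR_left
        bounded_linear_imp_has_derivative blP C_infinity_onD[OF smooth_\<Omega> that])
  then have bld: "bounded_linear (d\<Phi> z)" if "z \<in> U" for z
    using that has_derivative_bounded_linear by blast
  then have ap: "blinfun_apply (Blinfun (d\<Phi> z)) = d\<Phi> z" if "z \<in> U" for z
    using that bounded_linear_Blinfun_apply by blast
  have cont: "continuous_on U (\<lambda>z. Blinfun (d\<Phi> z))"
  proof (rule continuous_on_blinfun_componentwise)
    fix b :: 'a
    have "continuous_on U (\<lambda>z. d\<Phi> z b)"
      unfolding d\<Phi>_def
      by (intro continuous_intros C_infinity_on_continuous C_infinity_on_D smooth_\<Omega>)
    then show "continuous_on U (\<lambda>z. blinfun_apply (Blinfun (d\<Phi> z)) b)"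
      by (simp add: ap cong: continuous_on_cong)
  qed
  \<comment> \<open>The range of \<open>P\<close> is orthogonal to all gradients. Pairing with
    \<open>P v\<close> therefore gives \<open>P v = 0\<close>, and pairing with \<open>v\<close>
    then leaves the sum of the squares of \<open>D w z0 v\<close>.\<close>
  have inj: "v = 0" if "d\<Phi> z0 v = 0" for v
  proof -
    have "d\<Phi> z0 v \<bullet> P v = P v \<bullet> P v"
      unfolding d\<Phi>_def by (simp add: inner_add_left inner_sum_left gr DP)
    then have Pv: "P v = 0" using that by simp
    have "d\<Phi> z0 v \<bullet> v = (\<Sum>w\<in>\<Omega>. (D w z0 v)\<^sup>2)"
      unfolding d\<Phi>_def by (simp add: inner_add_left inner_sum_left gr Pv power2_eq_square)
    then have "(\<Sum>w\<in>\<Omega>. (D w z0 v)\<^sup>2) = 0" using that by simp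
    then have "D w z0 v = 0" if "w \<in> \<Omega>" for w
      using that finite_\<Omega> by (simp add: sum_nonneg_eq_0_iff)
    then show ?thesis using PV Pv by metis
  qed
  have lin0: "linear (d\<Phi> z0)" using bld[OF \<open>z0 \<in> U\<close>] bounded_linear.linear by blast
  then have "inj (d\<Phi> z0)" using inj linear_injective_0 by blast
  then obtain h where h: "linear h" "h \<circ> d\<Phi> z0 = id"
    using linear_injective_left_inverse[OF lin0] by blast
  have blh: "bounded_linear h" using h by (simp add: linear_conv_bounded_linear)
  obtain B where B: "B > 0" "\<And>v. norm (h v) \<le> B * norm v"
    using bounded_linear.pos_bounded[OF blh] by (metis mult.commute)
  have hinv: "Blinfun h o\<^sub>L Blinfun (d\<Phi> z0) = id_blinfun"
    by (rule blinfun_eqI) (use h ap[OF \<open>z0 \<in> U\<close>] bounded_linear_Blinfun_apply[OF blh] in \<open>simp add: fun_eq_iff\<close>)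
  obtain U' W \<Psi> \<Psi>' where U': "open U'" "U' \<subseteq> U" "z0 \<in> U'" and W: "open W" "\<Phi> z0 \<in> W"
    and hom: "homeomorphism U' W \<Phi> \<Psi>"
    and der\<Psi>: "\<And>y. y \<in> W \<Longrightarrow> (\<Psi> has_derivative \<Psi>' y) (at y)"
    and \<Psi>': "\<And>y. y \<in> W \<Longrightarrow> \<Psi>' y = inv (blinfun_apply (Blinfun (d\<Phi> (\<Psi> y))))"
    and bij: "\<And>y. y \<in> W \<Longrightarrow> bij (blinfun_apply (Blinfun (d\<Phi> (\<Psi> y))))"
    by (rule inverse_function_theorem[OF open_U _ cont \<open>z0 \<in> U\<close> hinv, of \<Phi>]) (use der\<Phi> ap in auto)
  have \<Phi>0: "\<Phi> z0 = P z0" unfolding \<Phi>_def by (simp add: z0)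
  obtain \<delta> where \<delta>: "\<delta> > 0" "cball z0 \<delta> \<subseteq> U"
    and \<delta>': "\<And>z. z \<in> cball z0 \<delta> \<Longrightarrow> norm (Blinfun (d\<Phi> z) - Blinfun (d\<Phi> z0)) \<le> 1 / (2 * B)"
  proof -
    have "isCont (\<lambda>z. Blinfun (d\<Phi> z)) z0"
      using cont open_U \<open>z0 \<in> U\<close> continuous_on_eq_continuous_at by blast
    moreover have "1 / (2 * B) > 0" using B by simp
    ultimately obtain d where d: "d > 0"
      "\<And>z. dist z z0 < d \<Longrightarrow> dist (Blinfun (d\<Phi> z)) (Blinfun (d\<Phi> z0)) < 1 / (2 * B)"
      unfolding continuous_at_eps_delta by blast
    obtain e where e: "e > 0" "cball z0 e \<subseteq> U"
      using open_U \<open>z0 \<in> U\<close> open_contains_cball by blast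
    show thesis
    proof (rule that[of "min e (d / 2)"])
      show "norm (Blinfun (d\<Phi> z) - Blinfun (d\<Phi> z0)) \<le> 1 / (2 * B)" if "z \<in> cball z0 (min e (d / 2))" for z
        using d(2)[of z] that \<open>d > 0\<close> by (simp add: dist_norm norm_minus_commute)
    qed (use d e in auto)
  qed
  \<comment> \<open>The left inverse \<open>h\<close> bounds \<open>norm v\<close> by
    \<open>B\<close> times the norm of its image under \<open>d\<Phi> z0\<close>. A perturbation of
    norm at most \<open>1 / (2 * B)\<close> costs \<open>norm v / 2\<close>, hence the doubled
    constant.\<close>
  have low: "norm v \<le> 2 * B * norm (d\<Phi> z v)" if "z \<in> cball z0 \<delta>" for z v
  proof -
    have "z \<in> U" using \<delta>(2) that by blast
    have "norm (d\<Phi> z v - d\<Phi> z0 v) = norm (blinfun_apply (Blinfun (d\<Phi> z) - Blinfun (d\<Phi> z0)) v)"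
      by (simp add: blinfun.diff_left ap[OF \<open>z \<in> U\<close>] ap[OF \<open>z0 \<in> U\<close>])
    also have "\<dots> \<le> 1 / (2 * B) * norm v"
      using norm_blinfun[of "Blinfun (d\<Phi> z) - Blinfun (d\<Phi> z0)" v] mult_right_mono[OF \<delta>'[OF that], of "norm v"]
      by auto
    finally have *: "norm (d\<Phi> z v - d\<Phi> z0 v) \<le> norm v / (2 * B)" by simp
    have "norm (d\<Phi> z0 v) \<le> norm (d\<Phi> z v) + norm (d\<Phi> z v - d\<Phi> z0 v)"
      using norm_triangle_sub[of "d\<Phi> z0 v" "d\<Phi> z v"] by (simp add: norm_minus_commute)
    then have "B * norm (d\<Phi> z0 v) \<le> B * (norm (d\<Phi> z v) + norm v / (2 * B))"
      using * B(1) by (intro mult_left_mono) auto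
    moreover have "norm v \<le> B * norm (d\<Phi> z0 v)"
      using B(2)[of "d\<Phi> z0 v"] h(2) by (simp add: fun_eq_iff)
    moreover have "B * (norm (d\<Phi> z v) + norm v / (2 * B)) = B * norm (d\<Phi> z v) + norm v / 2"
      using B(1) by (simp add: distrib_left)
    ultimately show ?thesis by (simp add: mult.assoc)
  qed
  have "isCont \<Psi> (\<Phi> z0)"
    using der\<Psi>[OF W(2)] has_derivative_continuous by blast
  moreover have \<Psi>0: "\<Psi> (\<Phi> z0) = z0"
    using hom U'(3) homeomorphism_apply1 by blast
  ultimately obtain d where d: "d > 0" "\<And>y. dist y (\<Phi> z0) < d \<Longrightarrow> dist (\<Psi> y) z0 < \<delta>"
    unfolding continuous_at_eps_delta using \<delta>(1) by metis
  obtain e where e: "e > 0" "ball (\<Phi> z0) e \<subseteq> W"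
    using W open_contains_ball by blast
  obtain C where C: "C > 0" "\<And>v. norm (P v) \<le> C * norm v"
    using bounded_linear.pos_bounded[OF blP] by (metis mult.commute)
  \<comment> \<open>\<open>P\<close> stretches by at most \<open>C\<close>, so this radius keeps
    \<open>P s\<close> within \<open>min d e\<close> of \<open>P z0\<close>, which is
    \<open>\<Phi> z0\<close>.\<close>
  define Q where "Q = ball (P z0) (min d e / C)"
  have PQ: "P s \<in> W" "\<Psi> (P s) \<in> cball z0 \<delta>" if "s \<in> Q" for s
  proof -
    have "norm (P s - P z0) = norm (P (s - P z0))"
      by (simp add: linear_diff[OF linP] PP)
    also have "\<dots> \<le> C * norm (s - P z0)" by (rule C)
    also have "\<dots> < min d e"
      using that C(1) by (simp add: Q_def dist_norm norm_minus_commute field_simps)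
    finally have *: "dist (P s) (\<Phi> z0) < min d e" by (simp add: \<Phi>0 dist_norm)
    then show "P s \<in> W" using e(2) by (auto simp: dist_commute)
    show "\<Psi> (P s) \<in> cball z0 \<delta>" using d(2)[of "P s"] * by (simp add: dist_commute)
  qed
  show thesis
  proof (rule that[of "U' \<inter> P -` Q" Q "cball z0 \<delta>" "2 * B * C" "\<lambda>s. \<Psi> (P s)" "\<lambda>s v. \<Psi>' (P s) (P v)" P])
    have "open (P -` Q)"
      using blP by (intro open_vimage) (auto simp: Q_def linear_continuous_on)
    then show "open (U' \<inter> P -` Q)" using U' by blast
    show "z0 \<in> U' \<inter> P -` Q" using U' d e C by (simp add: Q_def)
    show "U' \<inter> P -` Q \<subseteq> U" using U' by blast
    show "open Q" "convex Q" by (simp_all add: Q_def)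
    show "compact (cball z0 \<delta>)" "cball z0 \<delta> \<subseteq> U" using \<delta> by auto
    show "2 * B * C \<ge> 0" using B C by simp
    show "bounded_linear P" by (rule blP)
    show "\<Psi> (P s) \<in> cball z0 \<delta>" if "s \<in> Q" for s by (rule PQ[OF that])
    show "((\<lambda>s. \<Psi> (P s)) has_derivative (\<lambda>v. \<Psi>' (P s) (P v))) (at s)" if "s \<in> Q" for s
      by (rule has_derivative_compose[OF bounded_linear_imp_has_derivative[OF blP]]) (use der\<Psi> PQ that in auto)
    show "norm (\<Psi>' (P s) (P v)) \<le> 2 * B * C * norm v" if "s \<in> Q" for s v
    proof -
      let ?z = "\<Psi> (P s)"
      have "?z \<in> U" using PQ(2)[OF that] \<delta>(2) by blast
      then have "d\<Phi> ?z (\<Psi>' (P s) (P v)) = P v"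
        using \<Psi>'[OF PQ(1)[OF that]] bij[OF PQ(1)[OF that]] by (simp add: ap bij_is_surj surj_f_inv_f)
      then have "norm (\<Psi>' (P s) (P v)) \<le> 2 * B * norm (P v)"
        using low[OF PQ(2)[OF that], of "\<Psi>' (P s) (P v)"] by simp
      also have "\<dots> \<le> 2 * B * (C * norm v)"
        using B(1) C(2)[of v] by (intro mult_left_mono) auto
      finally show ?thesis by (simp add: mult.assoc)
    qed
    \<comment> \<open>The equation \<open>\<Phi> ?z = P s\<close> equates a combination of gradients
      with a vector in the range of \<open>P\<close>. These are orthogonal, so both vanish, and
      independence of the gradients kills the coefficients \<open>w ?z\<close>.\<close>
    show "w (\<Psi> (P s)) = 0" if "s \<in> Q" "w \<in> \<Omega>" for s w
    proof -
      let ?z = "\<Psi> (P s)"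
      have "\<Phi> ?z = P s"
        using hom PQ(1)[OF that(1)] homeomorphism_apply2 by blast
      then have x: "(\<Sum>w\<in>\<Omega>. w ?z *\<^sub>R gr w) = P (s - ?z)" (is "?x = _")
        unfolding \<Phi>_def by (simp add: linear_diff[OF linP] algebra_simps)
      have "?x \<bullet> P (s - ?z) = 0"
        by (simp add: inner_sum_left gr DP)
      then have "?x = 0" unfolding x by simp
      then have "?x \<bullet> v = 0" for v by simp
      then have "(\<Sum>w\<in>\<Omega>. w ?z * D w z0 v) = 0" for v
        by (simp add: inner_sum_left gr)
      then show ?thesis
        using indep[OF \<open>z0 \<in> U\<close> _ that(2), of "\<lambda>w. w ?z"] by blast
    qed
    show "P z \<in> Q \<and> \<Psi> (P (P z)) = z" if "z \<in> U' \<inter> P -` Q" "\<And>w. w \<in> \<Omega> \<Longrightarrow> w z = 0" for z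
    proof -
      have "\<Phi> z = P z" unfolding \<Phi>_def by (simp add: that(2))
      then show ?thesis using that(1) hom by (auto simp: PP homeomorphism_def)
    qed
  qed
qed

section \<open>Estimates along a chart\<close>

context
  fixes Q :: "'a set" and K :: "'a set" and \<psi> :: "'a \<Rightarrow> 'a" and \<psi>' :: "'a \<Rightarrow> 'a \<Rightarrow> 'a" and L :: real
  assumes Q: "open Q" "convex Q" and K: "compact K" "K \<subseteq> U" and L: "L \<ge> 0"
    and \<psi>K: "\<And>s. s \<in> Q \<Longrightarrow> \<psi> s \<in> K"
    and \<psi>0: "\<And>s w. s \<in> Q \<Longrightarrow> w \<in> \<Omega> \<Longrightarrow> w (\<psi> s) = 0"
    and der\<psi>: "\<And>s. s \<in> Q \<Longrightarrow> (\<psi> has_derivative \<psi>' s) (at s)"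
    and \<psi>'L: "\<And>s v. s \<in> Q \<Longrightarrow> norm (\<psi>' s v) \<le> L * norm v"
begin

text \<open>Differentiating \<open>w (\<psi> s) = 0\<close> shows that \<open>\<psi>'\<close> takes
  tangent values. The frame expands these in the fields with coefficients bounded by
  \<open>L * norm v\<close>, and the mean value inequality on the segment finishes.\<close>

lemma chart_Lipschitz:
  assumes F: "C_infinity_on F U" and s: "s \<in> Q" "s' \<in> Q"
    and E: "\<And>u b. u \<in> closed_segment s s' \<Longrightarrow> b \<in> Basis \<Longrightarrow> \<bar>td T b F (\<psi> u)\<bar> \<le> E"
  shows "\<bar>F (\<psi> s') - F (\<psi> s)\<bar> \<le> real DIM('a) * L * E * norm (s' - s)"
proof -
  have sub: "closed_segment s s' \<subseteq> Q"
    using Q(2) s by (simp add: closed_segment_subset)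
  have comp: "((\<lambda>u. G (\<psi> u)) has_derivative (\<lambda>v. D G (\<psi> u) (\<psi>' u v))) (at u)"
    if "C_infinity_on G U" "u \<in> Q" for G :: "'a \<Rightarrow> real" and u
  proof -
    have "\<psi> u \<in> U" using \<psi>K[OF that(2)] K(2) by blast
    have "(G has_derivative D G (\<psi> u)) (at (\<psi> u))"
      by (rule C_infinity_onD[OF that(1) \<open>\<psi> u \<in> U\<close>])
    with der\<psi>[OF that(2)] show ?thesis
      by (rule has_derivative_compose)
  qed
  have tan: "D w (\<psi> u) (\<psi>' u v) = 0" if "w \<in> \<Omega>" "u \<in> Q" for w u v
  proof -
    have "((\<lambda>_. 0 :: real) has_derivative (\<lambda>_. 0)) (at u)" by (rule has_derivative_const)
    then have 0: "((\<lambda>u. w (\<psi> u)) has_derivative (\<lambda>_. 0)) (at u)"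
      by (rule has_derivative_transform_within_open[OF _ Q(1) that(2)]) (simp add: \<psi>0 that(1))
    have "(\<lambda>v. D w (\<psi> u) (\<psi>' u v)) = (\<lambda>_. 0)"
      by (rule has_derivative_unique[OF comp[OF smooth_\<Omega>[OF that(1)] that(2)] 0])
    then show ?thesis by (rule fun_cong)
  qed
  have bound: "\<bar>D F (\<psi> u) (\<psi>' u v)\<bar> \<le> real DIM('a) * L * E * norm v" if "u \<in> closed_segment s s'" for u v
  proof -
    have "u \<in> Q" "\<psi> u \<in> U" using that sub \<psi>K K(2) by blast+
    let ?x = "\<psi>' u v"
    have "linear (D F (\<psi> u))"
      using C_infinity_onD[OF F \<open>\<psi> u \<in> U\<close>] has_derivative_linear by blast
    then have "D F (\<psi> u) (\<Sum>b\<in>Basis. (?x \<bullet> b) *\<^sub>R T (\<psi> u) b) = (\<Sum>b\<in>Basis. (?x \<bullet> b) * td T b F (\<psi> u))"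
      by (simp add: linear_sum linear_cmul td_def)
    then have "D F (\<psi> u) ?x = (\<Sum>b\<in>Basis. (?x \<bullet> b) * td T b F (\<psi> u))"
      using frame[OF \<open>\<psi> u \<in> U\<close> tan[OF _ \<open>u \<in> Q\<close>]] by simp
    also have "\<bar>\<dots>\<bar> \<le> (\<Sum>b\<in>Basis. \<bar>(?x \<bullet> b) * td T b F (\<psi> u)\<bar>)" by (rule sum_abs)
    also have "\<dots> \<le> (\<Sum>b\<in>(Basis :: 'a set). (L * norm v) * E)"
      unfolding abs_mult
    proof (intro sum_mono mult_mono)
      fix b :: 'a assume b: "b \<in> Basis"
      show "\<bar>?x \<bullet> b\<bar> \<le> L * norm v"
        using Basis_le_norm[OF b, of ?x] \<psi>'L[OF \<open>u \<in> Q\<close>, of v] by linarith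
    qed (use E[OF that] L in auto)
    finally show ?thesis by (simp add: mult_ac)
  qed
  have "norm (F (\<psi> s') - F (\<psi> s)) \<le> real DIM('a) * L * E * norm (s' - s)"
  proof (rule differentiable_bound[of "closed_segment s s'" "\<lambda>u. F (\<psi> u)" "\<lambda>u v. D F (\<psi> u) (\<psi>' u v)"])
    show "((\<lambda>u. F (\<psi> u)) has_derivative (\<lambda>v. D F (\<psi> u) (\<psi>' u v))) (at u within closed_segment s s')"
      if "u \<in> closed_segment s s'" for u
      using comp[OF F] that sub by (blast intro: has_derivative_at_withinI)
    show "onorm (\<lambda>v. D F (\<psi> u) (\<psi>' u v)) \<le> real DIM('a) * L * E" if "u \<in> closed_segment s s'" for u
      by (rule onorm_le) (use bound[OF that] in simp)
  qed auto
  then show ?thesis by simp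
qed

text \<open>On the segment from \<open>s\<close> the tangential derivatives are at most a constant
  times \<open>norm (s' - s) ^ n\<close>; integrating gains one power. Increments are estimated
  because in the final use \<open>F\<close> itself need not vanish at \<open>s\<close>.\<close>

lemma chart_increment_step:
  assumes F: "C_infinity_on F U"
    and est: "\<And>b. b \<in> Basis \<Longrightarrow> \<exists>A\<ge>0. \<forall>s\<in>Q. \<forall>s'\<in>Q.
      vanishing T n (td T b F) (\<psi> s) \<longrightarrow> \<bar>td T b F (\<psi> s')\<bar> \<le> A * norm (s' - s) ^ n"
  shows "\<exists>A\<ge>0. \<forall>s\<in>Q. \<forall>s'\<in>Q. (\<forall>b\<in>Basis. vanishing T n (td T b F) (\<psi> s)) \<longrightarrow>
      \<bar>F (\<psi> s') - F (\<psi> s)\<bar> \<le> A * norm (s' - s) ^ Suc n"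
proof -
  obtain A where A: "\<And>b. b \<in> Basis \<Longrightarrow> A b \<ge> 0"
    "\<And>b s s'. b \<in> Basis \<Longrightarrow> s \<in> Q \<Longrightarrow> s' \<in> Q \<Longrightarrow> vanishing T n (td T b F) (\<psi> s) \<Longrightarrow>
       \<bar>td T b F (\<psi> s')\<bar> \<le> A b * norm (s' - s) ^ n"
    using est by metis
  define C where "C = (\<Sum>b\<in>Basis. A b)"
  have "C \<ge> 0" unfolding C_def by (intro sum_nonneg A)
  have AC: "A b \<le> C" if "b \<in> Basis" for b
    unfolding C_def using that A(1) by (intro member_le_sum) auto
  have "\<bar>F (\<psi> s') - F (\<psi> s)\<bar> \<le> real DIM('a) * L * C * norm (s' - s) ^ Suc n"
    if s: "s \<in> Q" "s' \<in> Q" and van: "\<forall>b\<in>Basis. vanishing T n (td T b F) (\<psi> s)" for s s'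
  proof -
    have "\<bar>F (\<psi> s') - F (\<psi> s)\<bar> \<le> real DIM('a) * L * (C * norm (s' - s) ^ n) * norm (s' - s)"
    proof (rule chart_Lipschitz[OF F s])
      fix u b :: 'a assume u: "u \<in> closed_segment s s'" and b: "b \<in> Basis"
      have "u \<in> Q" using u Q(2) s closed_segment_subset by blast
      have "\<bar>td T b F (\<psi> u)\<bar> \<le> A b * norm (u - s) ^ n"
        using A(2)[OF b s(1) \<open>u \<in> Q\<close>] van b by simp
      also have "\<dots> \<le> C * norm (s' - s) ^ n"
        using AC[OF b] segment_bound1[OF u] \<open>C \<ge> 0\<close> by (intro mult_mono power_mono) auto
      finally show "\<bar>td T b F (\<psi> u)\<bar> \<le> C * norm (s' - s) ^ n" .
    qed
    then show ?thesis by (simp add: mult_ac)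
  qed
  then show ?thesis
    using L \<open>C \<ge> 0\<close> by (intro exI[of _ "real DIM('a) * L * C"]) auto
qed

text \<open>A Taylor estimate by induction on the order, starting from boundedness on the compact
  set \<open>K\<close>; only first derivatives of \<open>\<psi>\<close> enter.\<close>

lemma chart_vanishing_estimate:
  assumes "C_infinity_on F U"
  shows "\<exists>A\<ge>0. \<forall>s\<in>Q. \<forall>s'\<in>Q. vanishing T n F (\<psi> s) \<longrightarrow> \<bar>F (\<psi> s')\<bar> \<le> A * norm (s' - s) ^ n"
  using assms
proof (induction n arbitrary: F)
  case 0
  have "bounded (F ` K)"
    by (intro compact_imp_bounded compact_continuous_image K
        continuous_on_subset[OF C_infinity_on_continuous[OF 0] K(2)])
  then obtain A where A: "A > 0" "\<And>z. z \<in> K \<Longrightarrow> \<bar>F z\<bar> \<le> A"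
    by (auto simp: bounded_pos)
  show ?case
    by (rule exI[of _ A]) (simp add: A \<psi>K less_imp_le)
next
  case (Suc n)
  show ?case
    using chart_increment_step[OF Suc.prems Suc.IH[OF smooth_td[OF Suc.prems]]] by fastforce
qed

end

text \<open>Transfers the increment estimate from parameters to points, since \<open>P\<close> is
  Lipschitz and inverts the chart on the zero set.\<close>

lemma local_Holder_estimate:
  assumes F: "C_infinity_on F U" and z0: "z0 \<in> U" "\<And>w. w \<in> \<Omega> \<Longrightarrow> w z0 = 0"
  obtains V C where "open V" "z0 \<in> V"
    "\<And>z z'. z \<in> V \<Longrightarrow> z' \<in> V \<Longrightarrow> (\<And>w. w \<in> \<Omega> \<Longrightarrow> w z = 0 \<and> w z' = 0) \<Longrightarrow>
      (\<And>b. b \<in> Basis \<Longrightarrow> vanishing T n (td T b F) z) \<Longrightarrow> \<bar>F z' - F z\<bar> \<le> C * norm (z' - z) ^ Suc n"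
proof (rule chart[of z0])
  show "z0 \<in> U" by fact
  show "w z0 = 0" if "w \<in> \<Omega>" for w by (rule z0(2)[OF that])
next
  fix V Q K :: "'a set" and \<psi> \<psi>' L P
  assume V: "open V" "z0 \<in> V" "V \<subseteq> U"
    and ch: "open Q" "convex Q" "compact K" "K \<subseteq> U" "(L :: real) \<ge> 0"
    "\<And>s. s \<in> Q \<Longrightarrow> \<psi> s \<in> K"
    "\<And>s w. s \<in> Q \<Longrightarrow> w \<in> \<Omega> \<Longrightarrow> w (\<psi> s) = 0"
    "\<And>s. s \<in> Q \<Longrightarrow> (\<psi> has_derivative \<psi>' s) (at s)"
    "\<And>s v. s \<in> Q \<Longrightarrow> norm (\<psi>' s v) \<le> L * norm v"
    and P: "bounded_linear P"
    and V': "\<And>z. z \<in> V \<Longrightarrow> (\<And>w. w \<in> \<Omega> \<Longrightarrow> w z = 0) \<Longrightarrow> P z \<in> Q \<and> \<psi> (P z) = z"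
  have "\<exists>A\<ge>0. \<forall>s\<in>Q. \<forall>s'\<in>Q. (\<forall>b\<in>Basis. vanishing T n (td T b F) (\<psi> s)) \<longrightarrow>
      \<bar>F (\<psi> s') - F (\<psi> s)\<bar> \<le> A * norm (s' - s) ^ Suc n"
    by (rule chart_increment_step[where K = K and L = L and \<psi>' = \<psi>'])
      (use ch F in \<open>blast intro: smooth_td chart_vanishing_estimate[where K = K and L = L and \<psi>' = \<psi>']\<close>)+
  then obtain A where "A \<ge> 0" and A: "\<And>s s'. s \<in> Q \<Longrightarrow> s' \<in> Q \<Longrightarrow>
      (\<And>b. b \<in> Basis \<Longrightarrow> vanishing T n (td T b F) (\<psi> s)) \<Longrightarrow>
      \<bar>F (\<psi> s') - F (\<psi> s)\<bar> \<le> A * norm (s' - s) ^ Suc n" by blast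
  obtain B where B: "\<And>v. norm (P v) \<le> B * norm v"
    using bounded_linear.bounded[OF P] by (metis mult.commute)
  show thesis
  proof (rule that[of V "A * B ^ Suc n"])
    fix z z' assume z: "z \<in> V" "z' \<in> V" "\<And>w. w \<in> \<Omega> \<Longrightarrow> w z = 0 \<and> w z' = 0"
      and van: "\<And>b. b \<in> Basis \<Longrightarrow> vanishing T n (td T b F) z"
    have Pz: "P z \<in> Q" "\<psi> (P z) = z" "P z' \<in> Q" "\<psi> (P z') = z'"
      using V'[OF z(1)] V'[OF z(2)] z(3) by auto
    have "\<bar>F z' - F z\<bar> \<le> A * norm (P z' - P z) ^ Suc n"
      using A[OF Pz(1,3)] Pz van by simp
    also have "\<dots> \<le> A * (B * norm (z' - z)) ^ Suc n"
      using B[of "z' - z"] \<open>A \<ge> 0\<close>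
      by (intro mult_left_mono power_mono) (simp_all add: linear_diff[OF bounded_linear.linear[OF P]])
    finally show "\<bar>F z' - F z\<bar> \<le> A * B ^ Suc n * norm (z' - z) ^ Suc n"
      by (simp only: power_mult_distrib mult.assoc)
  qed (use V in auto)
qed

text \<open>Order \<open>DIM('a)\<close> for the first derivatives yields exponent
  \<open>Suc DIM('a)\<close>, which suffices for submanifolds of every dimension. Lindelof reduces
  the local statement to countably many neighbourhoods.\<close>

lemma negligible_tangentially_flat:
  assumes F: "C_infinity_on F U"
  shows "negligible (F ` {z\<in>U. (\<forall>w\<in>\<Omega>. w z = 0) \<and> (\<forall>b\<in>Basis. vanishing T DIM('a) (td T b F) z)})"
    (is "negligible (F ` ?S)")
proof -
  have "\<exists>V. open V \<and> z0 \<in> V \<and> negligible (F ` (?S \<inter> V))" if "z0 \<in> ?S" for z0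
  proof -
    show ?thesis
    proof (rule local_Holder_estimate[of F z0 "DIM('a)"])
      show "C_infinity_on F U" "z0 \<in> U" using F that by auto
      show "w z0 = 0" if "w \<in> \<Omega>" for w using \<open>z0 \<in> ?S\<close> that by auto
    next
      fix V C
      assume V: "open V" "z0 \<in> V"
        and C: "\<And>z z'. z \<in> V \<Longrightarrow> z' \<in> V \<Longrightarrow> (\<And>w. w \<in> \<Omega> \<Longrightarrow> w z = 0 \<and> w z' = 0) \<Longrightarrow>
          (\<And>b. b \<in> Basis \<Longrightarrow> vanishing T DIM('a) (td T b F) z) \<Longrightarrow>
          \<bar>F z' - F z\<bar> \<le> C * norm (z' - z) ^ Suc DIM('a)"
      have "negligible (F ` (?S \<inter> (V \<inter> ball z0 1)))"
      proof (rule negligible_image_Holder)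
        show "bounded (?S \<inter> (V \<inter> ball z0 1))"
          by (rule bounded_subset[OF bounded_ball[of z0 1]]) auto
        show "\<bar>F x - F y\<bar> \<le> C * norm (x - y) ^ Suc DIM('a)"
          if "x \<in> ?S \<inter> (V \<inter> ball z0 1)" "y \<in> ?S \<inter> (V \<inter> ball z0 1)" for x y
          by (rule C) (use that in auto)
      qed
      moreover have "open (V \<inter> ball z0 1)" "z0 \<in> V \<inter> ball z0 1" using V by auto
      ultimately show ?thesis by blast
    qed
  qed
  then have "\<forall>z0\<in>?S. \<exists>V. open V \<and> z0 \<in> V \<and> negligible (F ` (?S \<inter> V))"
    by (rule ballI)
  from bchoice[OF this]
  obtain V where V: "\<forall>z\<in>?S. open (V z) \<and> z \<in> V z \<and> negligible (F ` (?S \<inter> V z))" ..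
  obtain G where G: "G \<subseteq> V ` ?S" "countable G" "\<Union>G = \<Union>(V ` ?S)"
    using Lindelof[of "V ` ?S"] V by blast
  have "negligible (\<Union>((\<lambda>W. F ` (?S \<inter> W)) ` G))"
    using G V by (intro negligible_countable_Union) auto
  moreover have "F ` ?S \<subseteq> \<Union>((\<lambda>W. F ` (?S \<inter> W)) ` G)"
  proof
    fix r assume "r \<in> F ` ?S"
    then obtain z where z: "r = F z" "z \<in> ?S" by (rule imageE)
    then have "z \<in> \<Union>G" using G V by blast
    then show "r \<in> \<Union>((\<lambda>W. F ` (?S \<inter> W)) ` G)" using z by blast
  qed
  ultimately show ?thesis using negligible_subset by blast
qed

end

subsection \<open>Sard's theorem\<close>

text \<open>The index type of the values stays \<open>'k\<close> when \<open>I\<close> shrinks: the set is then a cylinder over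
  the coordinates in \<open>I\<close>.\<close>

definition crit_vals ::
  "'a::euclidean_space set \<Rightarrow> ('a \<Rightarrow> real) set \<Rightarrow> ('a \<Rightarrow> 'a \<Rightarrow> 'a) \<Rightarrow> ('k::finite \<Rightarrow> 'a \<Rightarrow> real) \<Rightarrow> 'k set
    \<Rightarrow> (real ^ 'k) set" where
  "crit_vals U \<Omega> T f I = {a. \<exists>z\<in>U. (\<forall>w\<in>\<Omega>. w z = 0) \<and>
    (\<exists>c :: real ^ 'k. (\<exists>i\<in>I. c $ i \<noteq> 0) \<and> (\<forall>b\<in>Basis. (\<Sum>i\<in>I. c $ i * td T b (f i) z) = 0)) \<and>
    (\<forall>i\<in>I. f i z = a $ i)}"

text \<open>Lists over the basis index all iterated tangential derivatives, a countable family; the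
  head of the list is applied first.\<close>

primrec word :: "('a::euclidean_space \<Rightarrow> 'a \<Rightarrow> 'a) \<Rightarrow> 'a list \<Rightarrow> ('a \<Rightarrow> real) \<Rightarrow> 'a \<Rightarrow> real" where
  "word T [] F = F"
| "word T (b # bs) F = word T bs (td T b F)"

text \<open>Starting from \<open>F z = 0\<close>, follow the derivatives that witness the failure
  until the first nonzero one; its predecessor is the word sought.\<close>

lemma not_vanishing_word:
  assumes "\<not> vanishing T n F z" "F z = 0"
  shows "\<exists>bs\<in>lists Basis. \<exists>b\<in>Basis. word T bs F z = 0 \<and> td T b (word T bs F) z \<noteq> 0"
  using assms
proof (induction n arbitrary: F)
  case (Suc n)
  then obtain b where b: "b \<in> Basis" "\<not> vanishing T n (td T b F) z" by auto
  show ?case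
  proof (cases "td T b F z = 0")
    case True
    obtain bs b' where *: "bs \<in> lists Basis" "b' \<in> Basis"
      "word T bs (td T b F) z = 0" "td T b' (word T bs (td T b F)) z \<noteq> 0"
      using Suc.IH[OF b(2) True] by blast
    then have "b # bs \<in> lists Basis" using b(1) by simp
    moreover have "word T (b # bs) F z = 0" "td T b' (word T (b # bs) F) z \<noteq> 0" using * by simp_all
    ultimately show ?thesis using \<open>b' \<in> Basis\<close> by blast
  next
    case False
    moreover have "word T [] F z = 0" "word T [] F = F" using Suc.prems by simp_all
    ultimately show ?thesis using b(1) lists.Nil by metis
  qed
qed simp

text \<open>The frame after \<open>g\<close> joins the constraints, where \<open>g\<close> has nonzero derivative along \<open>T z b0\<close>. The
  field of index \<open>b0\<close> becomes zero, which makes the induction in Sard's theorem terminate.\<close>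

definition refine ::
  "('a::euclidean_space \<Rightarrow> 'a \<Rightarrow> 'a) \<Rightarrow> ('a \<Rightarrow> real) \<Rightarrow> 'a \<Rightarrow> 'a \<Rightarrow> 'a \<Rightarrow> 'a" where
  "refine T g b0 = (\<lambda>z b. T z b - (td T b g z / td T b0 g z) *\<^sub>R T z b0)"

context tangent_frame begin

lemma smooth_word: "C_infinity_on F U \<Longrightarrow> bs \<in> lists Basis \<Longrightarrow> C_infinity_on (word T bs F) U"
  by (induction bs arbitrary: F) (auto intro: smooth_td)

lemma tangent_frame_subset:
  assumes "open V" "V \<subseteq> U"
  shows "tangent_frame V \<Omega> T"
proof unfold_locales
  fix z v assume "z \<in> V" and "\<And>w. w \<in> \<Omega> \<Longrightarrow> D w z v = 0"
  then show "(\<Sum>b\<in>Basis. (v \<bullet> b) *\<^sub>R T z b) = v" using assms frame by blast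
next
  fix z w and c :: "('a \<Rightarrow> real) \<Rightarrow> real"
  assume "z \<in> V" "\<And>v. (\<Sum>w\<in>\<Omega>. c w * D w z v) = 0" "w \<in> \<Omega>"
  then show "c w = 0" using assms indep by blast
qed (use assms finite_\<Omega> smooth_\<Omega> smooth_T tangent C_infinity_on_subset in blast)+

lemma open_td_nonzero:
  assumes "C_infinity_on g U" "b \<in> Basis"
  shows "open {z\<in>U. td T b g z \<noteq> 0}"
proof -
  have "open (U \<inter> td T b g -` (- {0}))"
    using C_infinity_on_continuous[OF smooth_td[OF assms]] open_U
    by (rule continuous_open_preimage) auto
  then show ?thesis by (simp add: vimage_def Int_def)
qed

text \<open>With the multiplier \<open>c\<close> as an additional variable the set is the projection
  of a zero set in an open set of triples \<open>(z, c, a)\<close>, because \<open>c\<close> being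
  nonzero on \<open>I\<close> is an open condition.\<close>

lemma crit_vals_borel:
  fixes f :: "'k::finite \<Rightarrow> 'a \<Rightarrow> real"
  assumes f: "\<And>i. i \<in> I \<Longrightarrow> C_infinity_on (f i) U"
  shows "crit_vals U \<Omega> T f I \<in> sets borel"
proof -
  let ?C = "{c :: real ^ 'k. \<exists>i\<in>I. c $ i \<noteq> 0}"
  let ?W = "U \<times> ?C \<times> (UNIV :: (real ^ 'k) set)"
  let ?\<Phi> = "(\<lambda>w q. w (fst q)) ` \<Omega> \<union> (\<lambda>b q. \<Sum>i\<in>I. fst (snd q) $ i * td T b (f i) (fst q)) ` Basis \<union>
     (\<lambda>i q. f i (fst q) - snd (snd q) $ i) ` I"
  have "open (\<Union>i\<in>I. {c :: real ^ 'k. c $ i \<noteq> 0})"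
    by (intro open_UN ballI open_Collect_neq continuous_intros)
  moreover have "(\<Union>i\<in>I. {c :: real ^ 'k. c $ i \<noteq> 0}) = ?C" by blast
  ultimately have "open ?W" using open_U by (intro open_Times) auto
  have cfst: "continuous_on ?W (\<lambda>q. F (fst q))" if "C_infinity_on F U" for F :: "'a \<Rightarrow> real"
    by (rule continuous_on_compose2[OF C_infinity_on_continuous[OF that]]) (auto intro: continuous_intros)
  have "(\<lambda>q. snd (snd q)) ` {q \<in> ?W. \<forall>\<phi>\<in>?\<Phi>. \<phi> q = 0} \<in> sets borel"
  proof (rule borel_image_zero_set[OF \<open>open ?W\<close>])
    show "finite ?\<Phi>" using finite_\<Omega> by simp
    show "continuous_on ?W \<phi>" if "\<phi> \<in> ?\<Phi>" for \<phi>
      using that by (auto intro!: continuous_intros cfst intro: smooth_\<Omega> smooth_td f)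
    show "continuous_on ?W (\<lambda>q. snd (snd q))" by (intro continuous_intros)
  qed
  also have "(\<lambda>q. snd (snd q)) ` {q \<in> ?W. \<forall>\<phi>\<in>?\<Phi>. \<phi> q = 0} = crit_vals U \<Omega> T f I"
  proof (intro equalityI subsetI)
    fix a assume "a \<in> crit_vals U \<Omega> T f I"
    then obtain z c where "z \<in> U" "\<forall>w\<in>\<Omega>. w z = 0" "c \<in> ?C"
      "\<forall>b\<in>Basis. (\<Sum>i\<in>I. c $ i * td T b (f i) z) = 0" "\<forall>i\<in>I. f i z = a $ i"
      unfolding crit_vals_def by blast
    then have "(z, c, a) \<in> {q \<in> ?W. \<forall>\<phi>\<in>?\<Phi>. \<phi> q = 0}" by auto
    then show "a \<in> (\<lambda>q. snd (snd q)) ` {q \<in> ?W. \<forall>\<phi>\<in>?\<Phi>. \<phi> q = 0}"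
      by (rule rev_image_eqI) simp
  next
    fix a assume "a \<in> (\<lambda>q. snd (snd q)) ` {q \<in> ?W. \<forall>\<phi>\<in>?\<Phi>. \<phi> q = 0}"
    then obtain q where q: "a = snd (snd q)" "q \<in> {q \<in> ?W. \<forall>\<phi>\<in>?\<Phi>. \<phi> q = 0}" by (rule imageE)
    define z c where "z = fst q" and "c = fst (snd q)"
    have "(z, c, a) \<in> {q \<in> ?W. \<forall>\<phi>\<in>?\<Phi>. \<phi> q = 0}" using q by (simp add: z_def c_def)
    then have "z \<in> U" "\<forall>w\<in>\<Omega>. w z = 0" "\<exists>i\<in>I. c $ i \<noteq> 0"
      "\<forall>b\<in>Basis. (\<Sum>i\<in>I. c $ i * td T b (f i) z) = 0" "\<forall>i\<in>I. f i z = a $ i"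
      by (auto simp: ball_Un)
    then show "a \<in> crit_vals U \<Omega> T f I" unfolding crit_vals_def by blast
  qed
  finally show ?thesis .
qed

section \<open>Passing to the hypersurface \<open>g = 0\<close>\<close>

lemma td_refine:
  assumes "C_infinity_on F U" "z \<in> U"
  shows "td (refine T g b0) b F z = td T b F z - td T b g z / td T b0 g z * td T b0 F z"
proof -
  have "linear (D F z)" using C_infinity_onD[OF assms] has_derivative_linear by blast
  then show ?thesis by (simp add: td_def refine_def linear_diff linear_cmul)
qed

text \<open>The correction cancels the derivative of \<open>g\<close> and preserves tangency to the
  old constraints. For \<open>v\<close> with \<open>D g z v = 0\<close> the corrections sum to zero,
  so the frame identity survives. Testing a linear relation on \<open>T z b0\<close> isolates the
  coefficient of \<open>g\<close>.\<close>

lemma tangent_frame_refine: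
  assumes g: "C_infinity_on g U" and b0: "b0 \<in> Basis"
  shows "tangent_frame {z\<in>U. td T b0 g z \<noteq> 0} (insert g \<Omega>) (refine T g b0)"
proof
  let ?U = "{z\<in>U. td T b0 g z \<noteq> 0}"
  have sub: "?U \<subseteq> U" by blast
  show "open ?U" by (rule open_td_nonzero[OF g b0])
  show "finite (insert g \<Omega>)" using finite_\<Omega> by simp
  show "C_infinity_on w ?U" if "w \<in> insert g \<Omega>" for w
    using that g smooth_\<Omega> by (blast intro: C_infinity_on_subset[OF _ sub])
  show "C_infinity_on (\<lambda>z. refine T g b0 z b \<bullet> c) ?U" if "b \<in> Basis" "c \<in> Basis" for b c
    unfolding refine_def inner_diff_left inner_scaleR_left
    by (intro C_infinity_on_diff C_infinity_on_mult C_infinity_on_divide \<open>open ?U\<close>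
        C_infinity_on_subset[OF _ sub] smooth_td smooth_T g b0 that) simp
  show "D w z (refine T g b0 z b) = 0" if z: "z \<in> ?U" and w: "w \<in> insert g \<Omega>" and "b \<in> Basis" for z w b
  proof -
    have "C_infinity_on w U" using w g smooth_\<Omega> by blast
    then have "D w z (refine T g b0 z b) = td T b w z - td T b g z / td T b0 g z * td T b0 w z"
      using td_refine[of w z g b0 b] z by (simp add: td_def)
    also have "\<dots> = 0"
    proof (cases "w = g")
      case False
      then show ?thesis using w z tangent \<open>b \<in> Basis\<close> b0 by (simp add: td_def)
    qed (use z in simp)
    finally show ?thesis .
  qed
  show "(\<Sum>b\<in>Basis. (v \<bullet> b) *\<^sub>R refine T g b0 z b) = v"
    if z: "z \<in> ?U" and v: "\<And>w. w \<in> insert g \<Omega> \<Longrightarrow> D w z v = 0" for z v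
  proof -
    have "z \<in> U" using z by blast
    have *: "(\<Sum>b\<in>Basis. (v \<bullet> b) *\<^sub>R T z b) = v"
      using frame[OF \<open>z \<in> U\<close>] v by blast
    have "linear (D g z)" using C_infinity_onD[OF g \<open>z \<in> U\<close>] has_derivative_linear by blast
    then have "(\<Sum>b\<in>Basis. (v \<bullet> b) * td T b g z) = D g z (\<Sum>b\<in>Basis. (v \<bullet> b) *\<^sub>R T z b)"
      by (simp add: td_def linear_sum linear_cmul)
    also have "\<dots> = 0" unfolding * by (rule v) simp
    finally have 0: "(\<Sum>b\<in>Basis. (v \<bullet> b) * td T b g z) = 0" .
    have "(\<Sum>b\<in>Basis. (v \<bullet> b) *\<^sub>R refine T g b0 z b) =
        (\<Sum>b\<in>Basis. (v \<bullet> b) *\<^sub>R T z b) - ((\<Sum>b\<in>Basis. (v \<bullet> b) * td T b g z) / td T b0 g z) *\<^sub>R T z b0"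
      unfolding refine_def
      by (simp add: scaleR_diff_right sum_subtractf sum_divide_distrib scaleR_sum_left)
    then show ?thesis unfolding 0 * by simp
  qed
  show "c w = 0" if z: "z \<in> ?U" and c: "\<And>v. (\<Sum>w\<in>insert g \<Omega>. c w * D w z v) = 0" and w: "w \<in> insert g \<Omega>"
    for z w and c :: "('a \<Rightarrow> real) \<Rightarrow> real"
  proof -
    have "z \<in> U" "D g z (T z b0) \<noteq> 0" using z by (auto simp: td_def)
    then have "g \<notin> \<Omega>" using tangent b0 by blast
    then have sum: "c g * D g z v + (\<Sum>w\<in>\<Omega>. c w * D w z v) = 0" for v
      using c[of v] finite_\<Omega> by simp
    have "(\<Sum>w\<in>\<Omega>. c w * D w z (T z b0)) = 0"
      using tangent[OF \<open>z \<in> U\<close> _ b0] by simp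
    then have "c g = 0" using sum[of "T z b0"] \<open>D g z (T z b0) \<noteq> 0\<close> by simp
    then show ?thesis using w sum indep[OF \<open>z \<in> U\<close>, of c] by auto
  qed
qed

text \<open>Fields that are zero stay zero, and the field of index \<open>b0\<close>, nonzero where
  \<open>td T b0 g\<close> is, becomes zero.\<close>

lemma card_refine_less:
  assumes g: "C_infinity_on g U" and b0: "b0 \<in> Basis" and ne: "{z\<in>U. td T b0 g z \<noteq> 0} \<noteq> {}"
  shows "card {b\<in>Basis. \<exists>z\<in>{z\<in>U. td T b0 g z \<noteq> 0}. refine T g b0 z b \<noteq> 0} < card {b\<in>Basis. \<exists>z\<in>U. T z b \<noteq> 0}"
proof (rule psubset_card_mono)
  have 0: "td T b g z = 0" if "T z b = 0" "z \<in> U" for z b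
    using that has_derivative_linear[OF C_infinity_onD[OF g]] by (simp add: td_def linear_0)
  have "refine T g b0 z b = 0" if "T z b = 0" "z \<in> U" for z b
    using 0[OF that] that by (simp add: refine_def)
  then have "{b\<in>Basis. \<exists>z\<in>{z\<in>U. td T b0 g z \<noteq> 0}. refine T g b0 z b \<noteq> 0} \<subseteq> {b\<in>Basis. \<exists>z\<in>U. T z b \<noteq> 0}"
    by blast
  moreover have "b0 \<in> {b\<in>Basis. \<exists>z\<in>U. T z b \<noteq> 0}" using ne 0 b0 by blast
  moreover have "b0 \<notin> {b\<in>Basis. \<exists>z\<in>{z\<in>U. td T b0 g z \<noteq> 0}. refine T g b0 z b \<noteq> 0}"
    by (auto simp: refine_def)
  ultimately show "{b\<in>Basis. \<exists>z\<in>{z\<in>U. td T b0 g z \<noteq> 0}. refine T g b0 z b \<noteq> 0} \<subset> {b\<in>Basis. \<exists>z\<in>U. T z b \<noteq> 0}"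
    by blast
qed simp

end

lemma negligible_crit_vals:
  fixes f :: "'k::finite \<Rightarrow> 'a::euclidean_space \<Rightarrow> real"
  assumes "tangent_frame U \<Omega> T" "\<And>i. i \<in> I \<Longrightarrow> C_infinity_on (f i) U"
  shows "negligible (crit_vals U \<Omega> T f I)"
  using assms
proof (induction "card {b\<in>Basis. \<exists>z\<in>U. T z b \<noteq> 0}" arbitrary: U \<Omega> T I rule: less_induct)
  case less
  interpret tangent_frame U \<Omega> T by fact
  have refined: "negligible (crit_vals {z\<in>U. td T b0 g z \<noteq> 0} (insert g \<Omega>) (refine T g b0) f J)"
    if "C_infinity_on g U" "b0 \<in> Basis" "J \<subseteq> I" for g b0 J
  \<comment> \<open>On an empty domain the induction measure need not drop, but there are no
    critical values either.\<close>
  proof (cases "{z\<in>U. td T b0 g z \<noteq> 0} = {}")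
    case True
    show ?thesis unfolding True crit_vals_def by simp
  next
    case False
    have "C_infinity_on (f i) {z\<in>U. td T b0 g z \<noteq> 0}" if "i \<in> J" for i
      by (rule C_infinity_on_subset[of _ U]) (use less.prems(2) \<open>J \<subseteq> I\<close> that in auto)
    then show ?thesis
      by (rule less.hyps[OF card_refine_less[OF that(1,2) False] tangent_frame_refine[OF that(1,2)]])
  qed
  \<comment> \<open>\<open>A\<close>: some \<open>f i0\<close> is not tangentially critical. \<open>E\<close>: all are, but some iterated tangential
    derivative \<open>g\<close> vanishes and has a nonzero derivative. \<open>G\<close>: they vanish up to a high order.\<close>
  define A where "A i0 b0 = crit_vals {z\<in>U. td T b0 (f i0) z \<noteq> 0} \<Omega> T f I" for i0 b0
  define E where "E i b bs b' = {a :: real ^ 'k. \<exists>z\<in>U. (\<forall>w\<in>\<Omega>. w z = 0) \<and>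
    word T bs (td T b (f i)) z = 0 \<and> td T b' (word T bs (td T b (f i))) z \<noteq> 0 \<and>
    (\<forall>i\<in>I. \<forall>b\<in>Basis. td T b (f i) z = 0) \<and> (\<forall>i\<in>I. f i z = a $ i)}" for i b bs b'
  define G where "G i = {a :: real ^ 'k. a $ i \<in>
    f i ` {z\<in>U. (\<forall>w\<in>\<Omega>. w z = 0) \<and> (\<forall>b\<in>Basis. vanishing T DIM('a) (td T b (f i)) z)}}" for i
  have A: "negligible (A i0 b0)" if i0: "i0 \<in> I" and b0: "b0 \<in> Basis" for i0 b0
  proof (rule negligible_coordinate_slices[where j = i0])
    let ?U = "{z\<in>U. td T b0 (f i0) z \<noteq> 0}"
    interpret V: tangent_frame ?U \<Omega> T
      by (rule tangent_frame_subset[OF open_td_nonzero[OF less.prems(2)[OF i0] b0]]) blast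
    show "A i0 b0 \<in> sets borel"
      unfolding A_def using less.prems(2) by (intro V.crit_vals_borel) (blast intro: C_infinity_on_subset)
    fix t
    \<comment> \<open>Fixing coordinate \<open>i0\<close> of the value at \<open>t\<close> puts the
      critical point on the hypersurface \<open>f i0 = t\<close>.\<close>
    define g where "g z = f i0 z - t" for z
    have g: "C_infinity_on g U"
      unfolding g_def using less.prems(2)[OF i0] by (intro C_infinity_on_diff open_U C_infinity_on_const)
    have Dg: "td T' b g z = td T' b (f i0) z" if "z \<in> U" for T' b z
    proof -
      have "(g has_derivative D (f i0) z) (at z)"
        unfolding g_def using has_derivative_diff[OF C_infinity_onD[OF less.prems(2)[OF i0] that] has_derivative_const[of t]]
        by simp
      then show ?thesis by (simp add: td_def D_eqI)
    qed
    have "{a. a + (t - a $ i0) *\<^sub>R axis i0 1 \<in> A i0 b0}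
      \<subseteq> crit_vals {z\<in>U. td T b0 g z \<noteq> 0} (insert g \<Omega>) (refine T g b0) f (I - {i0})"
    proof clarify
      fix a assume "a + (t - a $ i0) *\<^sub>R axis i0 1 \<in> A i0 b0"
      then obtain z c i1 where z: "z \<in> U" "td T b0 (f i0) z \<noteq> 0" "\<forall>w\<in>\<Omega>. w z = 0"
        and c: "i1 \<in> I" "c $ i1 \<noteq> 0" "\<forall>b\<in>Basis. (\<Sum>i\<in>I. c $ i * td T b (f i) z) = 0"
        and f: "\<forall>i\<in>I. f i z = (a + (t - a $ i0) *\<^sub>R axis i0 1) $ i"
        unfolding A_def crit_vals_def by blast
      have "f i0 z = t" using f i0 by simp
      have fa: "f i z = a $ i" if "i \<in> I - {i0}" for i
        using f that by (simp add: axis_def)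
      have split: "(\<Sum>i\<in>I. c $ i * F i) = c $ i0 * F i0 + (\<Sum>i\<in>I - {i0}. c $ i * F i)" for F
        by (rule sum.remove) (use i0 in auto)
      \<comment> \<open>A relation supported on \<open>i0\<close> alone would force
        \<open>td T b0 (f i0) z = 0\<close>.\<close>
      have "\<exists>i\<in>I - {i0}. c $ i \<noteq> 0"
      proof (rule ccontr)
        assume "\<not> (\<exists>i\<in>I - {i0}. c $ i \<noteq> 0)"
        then have 0: "c $ i = 0" if "i \<in> I - {i0}" for i using that by blast
        then have "c $ i0 * td T b0 (f i0) z = 0"
          using c(3) b0 split[of "\<lambda>i. td T b0 (f i) z"] by simp
        then show False using z(2) c 0 by (cases "i1 = i0") auto
      qed
      \<comment> \<open>The new fields are combinations of the old ones, so the relation persists;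
        they annihilate \<open>f i0\<close>, so its term drops out.\<close>
      moreover have "(\<Sum>i\<in>I - {i0}. c $ i * td (refine T g b0) b (f i) z) = 0" if "b \<in> Basis" for b
      proof -
        have td: "td (refine T g b0) b (f i) z = td T b (f i) z - td T b (f i0) z / td T b0 (f i0) z * td T b0 (f i) z"
          if "i \<in> I" for i
          using td_refine[OF less.prems(2)[OF that] z(1)] Dg[OF z(1)] by simp
        have "(\<Sum>i\<in>I. c $ i * td (refine T g b0) b (f i) z) =
          (\<Sum>i\<in>I. c $ i * td T b (f i) z - td T b (f i0) z / td T b0 (f i0) z * (c $ i * td T b0 (f i) z))"
          by (rule sum.cong) (simp_all add: td right_diff_distrib mult_ac)
        also have "\<dots> = (\<Sum>i\<in>I. c $ i * td T b (f i) z) -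
            td T b (f i0) z / td T b0 (f i0) z * (\<Sum>i\<in>I. c $ i * td T b0 (f i) z)"
          by (simp only: sum_subtractf sum_distrib_left)
        also have "\<dots> = 0" using c(3) b0 that by simp
        finally show ?thesis
          using split[of "\<lambda>i. td (refine T g b0) b (f i) z"] td[OF i0] z(2) by simp
      qed
      ultimately show "a \<in> crit_vals {z\<in>U. td T b0 g z \<noteq> 0} (insert g \<Omega>) (refine T g b0) f (I - {i0})"
        unfolding crit_vals_def
        using z fa Dg[OF z(1)] \<open>f i0 z = t\<close>
        by (intro CollectI bexI[of _ z] conjI exI[of _ c]) (auto simp: g_def)
    qed
    then show "negligible {a. a + (t - a $ i0) *\<^sub>R axis i0 1 \<in> A i0 b0}"
      using refined[OF g b0, of "I - {i0}"] negligible_subset by blast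
  qed
  have E: "negligible (E i b bs b')"
    if "i \<in> I" "b \<in> Basis" "bs \<in> lists Basis" "b' \<in> Basis" for i b bs b'
  proof -
    let ?g = "word T bs (td T b (f i))"
    have g: "C_infinity_on ?g U"
      using less.prems(2) that by (intro smooth_word smooth_td)
    have "E i b bs b' \<subseteq> crit_vals {z\<in>U. td T b' ?g z \<noteq> 0} (insert ?g \<Omega>) (refine T ?g b') f I"
    proof
      fix a assume "a \<in> E i b bs b'"
      then obtain z where z: "z \<in> U" "\<forall>w\<in>\<Omega>. w z = 0" "?g z = 0" "td T b' ?g z \<noteq> 0"
        "\<forall>i\<in>I. \<forall>b\<in>Basis. td T b (f i) z = 0" "\<forall>i\<in>I. f i z = a $ i"
        unfolding E_def by blast
      \<comment> \<open>Every derivative remains zero, so any nonzero multiplier shows criticality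
        on the hypersurface; \<open>axis i 1\<close> is chosen.\<close>
      have td0: "td (refine T ?g b') b'' (f i) z = 0" if "i \<in> I" "b'' \<in> Basis" for i b''
        using td_refine[OF less.prems(2)[OF that(1)] z(1)] z(5) that \<open>b' \<in> Basis\<close> by simp
      then show "a \<in> crit_vals {z\<in>U. td T b' ?g z \<noteq> 0} (insert ?g \<Omega>) (refine T ?g b') f I"
        unfolding crit_vals_def using z \<open>i \<in> I\<close>
        by (intro CollectI bexI[of _ z] conjI exI[of _ "axis i 1 :: real ^ 'k"] bexI[of _ i]) auto
    qed
    then show ?thesis using refined[OF g \<open>b' \<in> Basis\<close>, of I] negligible_subset by blast
  qed
  have G: "negligible (G i)" if "i \<in> I" for i
    unfolding G_def by (intro negligible_cylinder negligible_tangentially_flat less.prems(2) that)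
  have "crit_vals U \<Omega> T f I \<subseteq> (\<Union>i\<in>I. \<Union>b\<in>Basis. A i b) \<union>
      (\<Union>i\<in>I. \<Union>b\<in>Basis. \<Union>bs\<in>lists Basis. \<Union>b'\<in>Basis. E i b bs b') \<union> (\<Union>i\<in>I. G i)"
  proof
    fix a assume "a \<in> crit_vals U \<Omega> T f I"
    then obtain z c i where z: "z \<in> U" "\<forall>w\<in>\<Omega>. w z = 0" "\<forall>i\<in>I. f i z = a $ i"
      and c: "i \<in> I" "c $ i \<noteq> 0" "\<forall>b\<in>Basis. (\<Sum>i\<in>I. c $ i * td T b (f i) z) = 0"
      unfolding crit_vals_def by blast
    consider (regular) i0 b0 where "i0 \<in> I" "b0 \<in> Basis" "td T b0 (f i0) z \<noteq> 0"
      | (flat) "\<forall>b\<in>Basis. vanishing T DIM('a) (td T b (f i)) z"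
      | (finite) b where "b \<in> Basis" "\<not> vanishing T DIM('a) (td T b (f i)) z" "\<forall>i\<in>I. \<forall>b\<in>Basis. td T b (f i) z = 0"
      by blast
    then show "a \<in> (\<Union>i\<in>I. \<Union>b\<in>Basis. A i b) \<union>
      (\<Union>i\<in>I. \<Union>b\<in>Basis. \<Union>bs\<in>lists Basis. \<Union>b'\<in>Basis. E i b bs b') \<union> (\<Union>i\<in>I. G i)"
    proof cases
      case regular
      have "\<exists>c :: real ^ 'k. (\<exists>i\<in>I. c $ i \<noteq> 0) \<and> (\<forall>b\<in>Basis. (\<Sum>i\<in>I. c $ i * td T b (f i) z) = 0)"
        using c by (intro exI[of _ c] conjI bexI[of _ i])
      then have "a \<in> A i0 b0"
        unfolding A_def crit_vals_def using z regular by (intro CollectI bexI[of _ z] conjI)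
      then have "a \<in> (\<Union>i\<in>I. \<Union>b\<in>Basis. A i b)" using regular by (intro UN_I)
      then show ?thesis by (intro UnI1)
    next
      case flat
      then have "f i z \<in> f i ` {z\<in>U. (\<forall>w\<in>\<Omega>. w z = 0) \<and> (\<forall>b\<in>Basis. vanishing T DIM('a) (td T b (f i)) z)}"
        using z by blast
      then have "a \<in> G i" unfolding G_def using z(3) c(1) by simp
      then have "a \<in> (\<Union>i\<in>I. G i)" using c(1) by (intro UN_I)
      then show ?thesis by (rule UnI2)
    next
      case finite
      then obtain bs b' where bs: "bs \<in> lists Basis" "b' \<in> Basis" "word T bs (td T b (f i)) z = 0"
        "td T b' (word T bs (td T b (f i))) z \<noteq> 0"
        using not_vanishing_word[OF finite(2)] c(1) by blast
      then have "a \<in> E i b bs b'"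
        unfolding E_def using z finite by (intro CollectI bexI[of _ z] conjI)
      then have "a \<in> (\<Union>i\<in>I. \<Union>b\<in>Basis. \<Union>bs\<in>lists Basis. \<Union>b'\<in>Basis. E i b bs b')"
        using bs(1,2) finite(1) c(1) by (intro UN_I)
      then show ?thesis by (intro UnI1 UnI2)
    qed
  qed
  moreover have "negligible (\<Union>i\<in>I. \<Union>b\<in>Basis. A i b)"
    by (intro negligible_UN countable_finite) (simp_all add: A)
  moreover have "negligible (\<Union>i\<in>I. \<Union>b\<in>Basis. \<Union>bs\<in>lists Basis. \<Union>b'\<in>Basis. E i b bs b')"
    by (intro negligible_UN countable_finite countable_lists) (simp_all add: E)
  moreover have "negligible (\<Union>i\<in>I. G i)"
    by (intro negligible_UN countable_finite) (simp_all add: G)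
  ultimately show ?case using negligible_subset negligible_Un by metis
qed

lemma tangent_frame_UNIV: "open U \<Longrightarrow> tangent_frame U {} (\<lambda>z b. b)"
  by unfold_locales (auto simp: C_infinity_on_const euclidean_representation)

subsection \<open>Gradients and failure of LICQ\<close>

lemma inner_gradient:
  fixes f :: "'a::euclidean_space \<Rightarrow> real"
  assumes "(f has_derivative f') (at y)"
  shows "gradient f y \<bullet> v = f' v"
proof -
  define d where "d = (\<Sum>b\<in>Basis. f' b *\<^sub>R b)"
  have d: "u \<bullet> d = f' u" for u
  proof -
    have "f' (\<Sum>b\<in>Basis. (u \<bullet> b) *\<^sub>R b) = (\<Sum>b\<in>Basis. (u \<bullet> b) * f' b)"
      using has_derivative_linear[OF assms] by (simp add: linear_sum linear_cmul)
    then have "f' u = (\<Sum>b\<in>Basis. (u \<bullet> b) * f' b)"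
      by (simp only: euclidean_representation)
    then show ?thesis by (simp add: d_def inner_sum_right mult.commute)
  qed
  have "gradient f y = d"
    unfolding gradient_def
  proof (rule the_equality)
    show "GDERIV f y :> d" using assms d by (simp add: gderiv_def)
    fix e assume "GDERIV f y :> e"
    then have "(\<lambda>u. u \<bullet> e) = f'"
      unfolding gderiv_def using assms by (rule has_derivative_unique)
    then show "e = d" using d by (metis vector_eq_ldot)
  qed
  then show ?thesis using d[of v] by (simp add: inner_commute)
qed

text \<open>Two equal vectors with different indices give the coefficients 1 and -1; for an
  injective family a relation on the image is pulled back.\<close>

lemma dependent_family:
  fixes v :: "'k::finite \<Rightarrow> 'a::real_vector"
  assumes "\<not> (inj_on v J \<and> independent (v ` J))"
  shows "\<exists>c :: real ^ 'k. (\<exists>i\<in>J. c $ i \<noteq> 0) \<and> (\<Sum>i\<in>J. c $ i *\<^sub>R v i) = 0"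
proof (cases "inj_on v J")
  case True
  then have "dependent (v ` J)" using assms by blast
  then obtain u where u: "\<exists>x\<in>v ` J. u x \<noteq> 0" "(\<Sum>x\<in>v ` J. u x *\<^sub>R x) = 0"
    using dependent_finite[of "v ` J"] by auto
  then have "(\<Sum>i\<in>J. u (v i) *\<^sub>R v i) = 0"
    by (simp add: sum.reindex[OF True])
  then show ?thesis using u(1) by (intro exI[of _ "\<chi> i. u (v i)"]) auto
next
  case False
  then obtain i j where ij: "i \<in> J" "j \<in> J" "i \<noteq> j" "v i = v j"
    by (auto simp: inj_on_def)
  let ?c = "axis i 1 - axis j 1 :: real ^ 'k"
  have "(\<Sum>k\<in>J. ?c $ k *\<^sub>R v k) = (\<Sum>k\<in>J. (if k = i then v k else 0) - (if k = j then v k else 0))"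
    by (rule sum.cong) (auto simp: axis_def)
  also have "\<dots> = 0" using ij by (simp add: sum_subtractf)
  finally have "(\<Sum>k\<in>J. ?c $ k *\<^sub>R v k) = 0" .
  moreover have "?c $ i \<noteq> 0" using ij by (simp add: axis_def)
  ultimately show ?thesis using ij(1) by blast
qed

text \<open>The directions \<open>(0, b)\<close> give the partial derivatives in \<open>y\<close>:
  the slice at \<open>x\<close> consists of the \<open>a\<close> for which \<open>- a\<close>,
  restricted to \<open>I\<close>, is a critical value of the constraints in
  \<open>I\<close>.\<close>

definition param_crit ::
  "('a::euclidean_space \<times> 'b::euclidean_space) set \<Rightarrow> ('k::finite \<Rightarrow> 'a \<times> 'b \<Rightarrow> real) \<Rightarrow> 'k set
    \<Rightarrow> ('a \<times> (real ^ 'k)) set" where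
  "param_crit U h I = {(x, a). \<exists>y. (x, y) \<in> U \<and>
    (\<exists>c :: real ^ 'k. (\<exists>i\<in>I. c $ i \<noteq> 0) \<and> (\<forall>b\<in>Basis. (\<Sum>i\<in>I. c $ i * D (h i) (x, y) (0, b)) = 0)) \<and>
    (\<forall>i\<in>I. h i (x, y) + a $ i = 0)}"

text \<open>Supplies the joint measurability for Fubini, again by projecting a zero set, now in the
  variables \<open>((x, y), c, a)\<close>.\<close>

lemma param_crit_borel:
  fixes h :: "'k::finite \<Rightarrow> 'a::euclidean_space \<times> 'b::euclidean_space \<Rightarrow> real"
  assumes "open U" and h: "\<And>i. C_infinity_on (h i) U"
  shows "param_crit U h I \<in> sets borel"
proof -
  let ?C = "{c :: real ^ 'k. \<exists>i\<in>I. c $ i \<noteq> 0}"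
  let ?W = "U \<times> ?C \<times> (UNIV :: (real ^ 'k) set)"
  let ?\<Phi> = "(\<lambda>b q. \<Sum>i\<in>I. fst (snd q) $ i * D (h i) (fst q) (0, b)) ` Basis \<union>
     (\<lambda>i q. h i (fst q) + snd (snd q) $ i) ` I"
  let ?p = "\<lambda>q. (fst (fst q), snd (snd q))"
  have "open (\<Union>i\<in>I. {c :: real ^ 'k. c $ i \<noteq> 0})"
    by (intro open_UN ballI open_Collect_neq continuous_intros)
  moreover have "(\<Union>i\<in>I. {c :: real ^ 'k. c $ i \<noteq> 0}) = ?C" by blast
  ultimately have "open ?W" using \<open>open U\<close> by (intro open_Times) auto
  have cfst: "continuous_on ?W (\<lambda>q. F (fst q))" if "C_infinity_on F U" for F :: "'a \<times> 'b \<Rightarrow> real"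
    by (rule continuous_on_compose2[OF C_infinity_on_continuous[OF that]]) (auto intro: continuous_intros)
  have "?p ` {q \<in> ?W. \<forall>\<phi>\<in>?\<Phi>. \<phi> q = 0} \<in> sets borel"
  proof (rule borel_image_zero_set[OF \<open>open ?W\<close>])
    show "finite ?\<Phi>" by simp
    show "continuous_on ?W \<phi>" if "\<phi> \<in> ?\<Phi>" for \<phi>
      using that by (auto intro!: continuous_intros cfst intro: C_infinity_on_D h)
    show "continuous_on ?W ?p" by (intro continuous_intros)
  qed
  also have "?p ` {q \<in> ?W. \<forall>\<phi>\<in>?\<Phi>. \<phi> q = 0} = param_crit U h I"
  proof (intro equalityI subsetI)
    fix r assume "r \<in> param_crit U h I"
    then obtain x a y c where "r = (x, a)" "(x, y) \<in> U" "c \<in> ?C"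
      "\<forall>b\<in>Basis. (\<Sum>i\<in>I. c $ i * D (h i) (x, y) (0, b)) = 0" "\<forall>i\<in>I. h i (x, y) + a $ i = 0"
      unfolding param_crit_def by blast
    then have "((x, y), c, a) \<in> {q \<in> ?W. \<forall>\<phi>\<in>?\<Phi>. \<phi> q = 0}" "r = ?p ((x, y), c, a)" by auto
    then show "r \<in> ?p ` {q \<in> ?W. \<forall>\<phi>\<in>?\<Phi>. \<phi> q = 0}" by (rule rev_image_eqI)
  next
    fix r assume "r \<in> ?p ` {q \<in> ?W. \<forall>\<phi>\<in>?\<Phi>. \<phi> q = 0}"
    then obtain q where q: "r = ?p q" "q \<in> {q \<in> ?W. \<forall>\<phi>\<in>?\<Phi>. \<phi> q = 0}" by (rule imageE)
    define x y c a where "x = fst (fst q)" and "y = snd (fst q)" and "c = fst (snd q)" and "a = snd (snd q)"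
    have "((x, y), c, a) \<in> {q \<in> ?W. \<forall>\<phi>\<in>?\<Phi>. \<phi> q = 0}" and r: "r = (x, a)"
      using q by (simp_all add: x_def y_def c_def a_def)
    then have "(x, y) \<in> U" "\<exists>i\<in>I. c $ i \<noteq> 0"
      "\<forall>b\<in>Basis. (\<Sum>i\<in>I. c $ i * D (h i) (x, y) (0, b)) = 0" "\<forall>i\<in>I. h i (x, y) + a $ i = 0"
      by (auto simp: ball_Un)
    then show "r \<in> param_crit U h I" unfolding param_crit_def r by blast
  qed
  finally show ?thesis .
qed

lemma AE_param_crit:
  fixes h :: "'k::finite \<Rightarrow> 'a::euclidean_space \<times> 'b::euclidean_space \<Rightarrow> real"
  assumes "open U" and h: "\<And>i. C_infinity_on (h i) U"
  shows "AE a in lborel. AE x in lborel. (x, a) \<notin> param_crit U h I"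
proof -
  have borel: "param_crit U h I \<in> sets borel"
    by (rule param_crit_borel[OF \<open>open U\<close>]) (rule h)
  have slice: "Pair x -` param_crit U h I \<in> null_sets lborel" for x
  proof -
    \<comment> \<open>The sign turns \<open>h i (x, y) + a $ i = 0\<close> into the statement that
      \<open>a\<close> is a value of \<open>?f\<close>.\<close>
    let ?U = "{y. (x, y) \<in> U}" and ?f = "\<lambda>i y. - h i (x, y)"
    have op: "open ?U"
      using open_vimage[OF \<open>open U\<close>, of "Pair x"] by (simp add: vimage_def continuous_on_Pair)
    have sm: "C_infinity_on (\<lambda>y. h i (x, y)) ?U" for i
      using h[of i] C_k_on_slice[OF \<open>open U\<close>] unfolding C_infinity_on_def by blast
    have f: "C_infinity_on (?f i) ?U" for i
      using C_infinity_on_diff[OF op C_infinity_on_const[of 0] sm] by simp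
    have td: "td (\<lambda>z b. b) b (?f i) y = - D (h i) (x, y) (0, b)" if "(x, y) \<in> U" for b i y
    proof -
      have "D (?f i) y b = - D (\<lambda>y. h i (x, y)) y b"
        by (rule D_eqI[OF has_derivative_minus[OF C_infinity_onD[OF sm]]]) (use that in simp)
      then show ?thesis using D_slice[OF h that] by (simp add: td_def)
    qed
    have "Pair x -` param_crit U h I \<subseteq> crit_vals ?U {} (\<lambda>z b. b) ?f I"
    proof
      fix a assume "a \<in> Pair x -` param_crit U h I"
      then obtain y c where y: "(x, y) \<in> U" and c: "\<exists>i\<in>I. c $ i \<noteq> 0"
        "\<forall>b\<in>Basis. (\<Sum>i\<in>I. c $ i * D (h i) (x, y) (0, b)) = 0" and a: "\<forall>i\<in>I. h i (x, y) + a $ i = 0"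
        unfolding param_crit_def by blast
      have "\<forall>b\<in>Basis. (\<Sum>i\<in>I. c $ i * td (\<lambda>z b. b) b (?f i) y) = 0"
        using c(2) by (simp add: td[OF y] sum_negf)
      moreover have "\<forall>i\<in>I. ?f i y = a $ i" using a by (simp add: add_eq_0_iff)
      ultimately show "a \<in> crit_vals ?U {} (\<lambda>z b. b) ?f I"
        unfolding crit_vals_def using y c(1) by (intro CollectI bexI[of _ y] conjI exI[of _ c]) auto
    qed
    moreover have "negligible (crit_vals ?U {} (\<lambda>z b. b) ?f I)"
      by (rule negligible_crit_vals[OF tangent_frame_UNIV[OF op] f])
    ultimately have neg: "negligible (Pair x -` param_crit U h I)"
      by (rule negligible_subset[rotated])
    have "param_crit U h I \<in> sets (borel \<Otimes>\<^sub>M borel)"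
      unfolding borel_prod by (rule borel)
    from sets_Pair1[OF this, of x] have "Pair x -` param_crit U h I \<in> sets lborel" by simp
    with neg show ?thesis
      by (simp add: negligible_iff_null_sets null_sets_completion_iff)
  qed
  have "AE a in lborel. (x, a) \<notin> param_crit U h I" for x
    using AE_not_in[OF slice[of x]] by simp
  then have "AE x in lborel. AE a in lborel. (x, a) \<notin> param_crit U h I"
    by simp
  moreover have "{q \<in> space (lborel \<Otimes>\<^sub>M lborel). (fst q, snd q) \<notin> param_crit U h I} \<in> sets (lborel \<Otimes>\<^sub>M lborel)"
  proof -
    have "- param_crit U h I \<in> sets borel" using borel by simp
    moreover have "{q \<in> space (lborel \<Otimes>\<^sub>M lborel). (fst q, snd q) \<notin> param_crit U h I} = - param_crit U h I"
      by (auto simp: space_pair_measure)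
    ultimately show ?thesis unfolding lborel_prod by simp
  qed
  ultimately show ?thesis
    using lborel_pair.AE_commute[of "\<lambda>x a. (x, a) \<notin> param_crit U h I"] by blast
qed

text \<open>Adding constants does not change gradients, so dependence of the active ones is a
  relation between the partial derivatives of \<open>h\<close> in \<open>y\<close>.\<close>

lemma not_LICQ_param_crit:
  fixes h :: "'k::finite \<Rightarrow> 'a::euclidean_space \<times> 'b::euclidean_space \<Rightarrow> real"
  assumes h: "\<And>i. C_infinity_on (h i) U" and "(x, y) \<in> U" and "\<not> LICQ_at (perturb h a) x y"
  shows "(x, a) \<in> param_crit U h (active_set (perturb h a) x y)"
proof -
  let ?J = "active_set (perturb h a) x y"
  let ?v = "\<lambda>i. gradient (\<lambda>y'. perturb h a i (x, y')) y"
  obtain c :: "real ^ 'k" where c: "\<exists>i\<in>?J. c $ i \<noteq> 0" "(\<Sum>i\<in>?J. c $ i *\<^sub>R ?v i) = 0"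
    using dependent_family assms(3) unfolding LICQ_at_def by blast
  have v: "?v i \<bullet> b = D (h i) (x, y) (0, b)" for i b
  proof (rule inner_gradient)
    have "((\<lambda>y'. h i (x, y')) has_derivative (\<lambda>b. D (h i) (x, y) (0, b))) (at y)"
      by (rule has_derivative_slice[OF C_infinity_onD[OF h \<open>(x, y) \<in> U\<close>]])
    then show "((\<lambda>y'. perturb h a i (x, y')) has_derivative (\<lambda>b. D (h i) (x, y) (0, b))) (at y)"
      unfolding perturb_def using has_derivative_add_const by blast
  qed
  have "(\<Sum>i\<in>?J. c $ i * D (h i) (x, y) (0, b)) = (\<Sum>i\<in>?J. c $ i *\<^sub>R ?v i) \<bullet> b" for b
    by (simp add: inner_sum_left v)
  then have "\<forall>b\<in>Basis. (\<Sum>i\<in>?J. c $ i * D (h i) (x, y) (0, b)) = 0" by (simp add: c(2))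
  moreover have "\<forall>i\<in>?J. h i (x, y) + a $ i = 0" by (simp add: active_set_def perturb_def)
  ultimately show ?thesis
    unfolding param_crit_def using c(1) \<open>(x, y) \<in> U\<close> by blast
qed

theorem theorem3p1:
  fixes X :: "(real ^ 'n) set"
    and U :: "((real ^ 'n) \<times> (real ^ 'm)) set"
    and g :: "(real ^ 'n) \<times> (real ^ 'm) \<Rightarrow> real"
    and h :: "'k::finite \<Rightarrow> (real ^ 'n) \<times> (real ^ 'm) \<Rightarrow> real"
    and \<rho> \<nu> :: real
  assumes "X \<in> sets lebesgue"
    and "open U" and "X \<times> UNIV \<subseteq> U"
    and "C_infinity_on g U"
    and "\<And>i. C_infinity_on (h i) U"
    and "\<rho> > 0"
    and "\<And>x. x \<in> X \<Longrightarrow> \<exists>y \<in> interior (feasible_set h x). \<forall>i. h i (x, y) \<le> - \<rho>"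
    and "0 < \<nu>" and "\<nu> < \<rho>"
  shows "AE a in uniform_measure lborel (cbox 0 (\<chi> i. \<nu>) :: (real ^ 'k) set).
    {x \<in> X. \<exists>y \<in> feasible_set (perturb h a) x. \<not> LICQ_at (perturb h a) x y} \<in> null_sets lebesgue"
proof (rule AE_uniform_measureI)
  show "cbox 0 (\<chi> i. \<nu>) \<in> sets (lborel :: (real ^ 'k) measure)" by simp
  \<comment> \<open>The active set varies with the point, but there are only finitely many
    candidates \<open>I\<close>.\<close>
  have "AE a in lborel. \<forall>I\<in>UNIV. AE x in lborel. (x, a) \<notin> param_crit U h I"
    by (rule AE_finite_allI) (simp_all add: AE_param_crit assms(2,5))
  then show "AE a in lborel. a \<in> cbox 0 (\<chi> i. \<nu>) \<longrightarrow>
    {x \<in> X. \<exists>y \<in> feasible_set (perturb h a) x. \<not> LICQ_at (perturb h a) x y} \<in> null_sets lebesgue"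
  proof eventually_elim
    case (elim a)
    then have "AE x in lborel. \<forall>I\<in>UNIV. (x, a) \<notin> param_crit U h I"
      by (intro AE_finite_allI) simp_all
    then obtain N where N: "N \<in> null_sets lborel" "{x \<in> space lborel. \<not> (\<forall>I\<in>UNIV. (x, a) \<notin> param_crit U h I)} \<subseteq> N"
      unfolding eventually_ae_filter by blast
    \<comment> \<open>Covering the bad set by a Borel null set suffices, since Lebesgue measure is
      complete; the active set at the bad point serves as \<open>I\<close>.\<close>
    have "{x \<in> X. \<exists>y \<in> feasible_set (perturb h a) x. \<not> LICQ_at (perturb h a) x y} \<subseteq> N"
      using N(2) not_LICQ_param_crit[OF assms(5)] assms(3) by fastforce
    then show ?case
      unfolding null_sets_completion_iff2 using N(1) by blast
  qed
qed

end
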